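(* For every skew shifted shape $\nu/\mu$ (that is, strict partitions $\mu\subseteq\nu$) there is a signed permutation $w$ with $G^C_w=GQ^{(\beta)}_{\nu/\mu}$.
   Context: **Signed permutations.** $W_n$ is the group of bijections $w$ of $\{-n,\dots,-1,1,\dots,n\}$ with $w(-i)=-w(i)$; Coxeter generators $s_0=(-1\ 1)$, $s_i=(-i{-}1\ \,{-}i)(i\ \,i{+}1)$ for $1\le i\le n-1$. **$G^C_w$.** Let $u_0,\dots,u_{n-1}$ be noncommuting variables (commuting with $\beta$ and $x_1,x_2,\dots$) with $u_i^2=\beta u_i$, $u_1u_0u_1u_0=u_0u_1u_0u_1$, $u_iu_{i+1}u_i=u_{i+1}u_iu_{i+1}$ ($i>0$), $u_iu_j=u_ju_i$ ($|i-j|>1$). For $w\in W_n$ with reduced word $(a_1,\dots,a_\ell)$ put $u_w=u_{a_1}\cdots u_{a_\ell}$. $G^C_w$ is the coefficient of $u_w$ in $$\prod_{i\ge1}(1+x_iu_{n-1})\cdots(1+x_iu_1)(1+x_iu_0)(1+x_iu_0)(1+x_iu_1)\cdots(1+x_iu_{n-1}),$$ the product taken in order $i=1,2,\dots$ from left to right. **$GQ$.** A strict partition is $\lambda=(\lambda_1>\dots>\lambda_k>0)$, with shifted diagram $D_\lambda=\{(i,j):1\le i\le k,\ i\le j\le\lambda_i+i-1\}$; $\mu\subseteq\nu$ means $D_\mu\subseteq D_\nu$, and $D_{\nu/\mu}=D_\nu\setminus D_\mu$, $|\nu/\mu|=|D_{\nu/\mu}|$. Order $\mathbb{Z}\setminus\{0\}$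 by $\bar1\prec1\prec\bar2\prec2\prec\cdots$, where $\bar a=-a$. A shifted set-valued semistandard tableau of shape $\nu/\mu$ is a filling $T$ of $D_{\nu/\mu}$ by finite nonempty subsets of $\mathbb{Z}\setminus\{0\}$ with $\max T_{ij}\preceq\min T_{i+1,j}$, equality allowed only for negative values, and $\max T_{ij}\preceq\min T_{i,j+1}$, equality allowed only for positive values (whenever the cells exist; $\max,\min$ with respect to $\prec$). With $|T|=\sum|T_{ij}|$ and $x^T=\prod_{(i,j)}\prod_{s\in T_{ij}}x_{|s|}$, set $GQ^{(\beta)}_{\nu/\mu}=\sum_T\beta^{|T|-|\nu/\mu|}x^T$. *)

theory Defs
  imports
    "HOL-Library.Poly_Mapping"
    "HOL-Computational_Algebra.Polynomial"
    "HOL-Combinatorics.Permutations"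
begin

subsection \<open>Signed permutations\<close>

text \<open>Elements of \<open>W\<^sub>n\<close> are functions on all integers that fix every integer outside
  \<open>{-n,\<dots>,-1,1,\<dots>,n}\<close>.\<close>

definition signed_perms :: "nat \<Rightarrow> (int \<Rightarrow> int) set" where
  "signed_perms n = {w. w permutes ({- int n..int n} - {0}) \<and> (\<forall>i. w (- i) = - w i)}"

definition cox_gen :: "nat \<Rightarrow> int \<Rightarrow> int" where
  "cox_gen i =
    (if i = 0 then transpose (- 1) 1
     else transpose (- int i - 1) (- int i) \<circ> transpose (int i) (int i + 1))"

definition word_perm :: "nat list \<Rightarrow> int \<Rightarrow> int" where
  "word_perm a = foldr (\<circ>) (map cox_gen a) id"

definition reduced_word :: "nat \<Rightarrow> (int \<Rightarrow> int) \<Rightarrow> nat list \<Rightarrow> bool" where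
  "reduced_word n w a \<longleftrightarrow>
    set a \<subseteq> {..<n} \<and> word_perm a = w \<and>
    (\<forall>b. set b \<subseteq> {..<n} \<and> word_perm b = w \<longrightarrow> length a \<le> length b)"

subsection \<open>The algebra generated by the variables \<open>u\<^sub>i\<close>\<close>

text \<open>The free monoid, written additively so that finitely supported functions on it form the
  free associative algebra with the convolution product of \<^typ>\<open>'a \<Rightarrow>\<^sub>0 'b\<close>.\<close>

datatype uword = UWord (letters: "nat list")

instantiation uword :: monoid_add
begin

definition zero_uword :: uword where
  "0 = UWord []"

definition plus_uword :: "uword \<Rightarrow> uword \<Rightarrow> uword" where
  "a + b = UWord (letters a @ letters b)"

instance
  by standard (simp_all add: zero_uword_def plus_uword_def)

end

type_synonym monom = "nat \<Rightarrow>\<^sub>0 nat"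

text \<open>Coefficients live in \<open>\<int>[\<beta>]\<close>, modelled as \<^typ>\<open>int poly\<close>.\<close>

type_synonym xpoly = "monom \<Rightarrow>\<^sub>0 int poly"
type_synonym xseries = "monom \<Rightarrow> int poly"
type_synonym ualg = "uword \<Rightarrow>\<^sub>0 xpoly"

definition beta :: "int poly" where
  "beta = [:0, 1:]"

definition xvar :: "nat \<Rightarrow> xpoly" where
  "xvar i = Poly_Mapping.single (Poly_Mapping.single i 1) 1"

definition scal :: "xpoly \<Rightarrow> ualg" where
  "scal c = Poly_Mapping.single 0 c"

definition ugen :: "nat \<Rightarrow> ualg" where
  "ugen i = Poly_Mapping.single (UWord [i]) 1"

definition free_ualg :: "nat \<Rightarrow> ualg set" where
  "free_ualg n = {f. \<forall>a \<in> Poly_Mapping.keys f. set (letters a) \<subseteq> {..<n}}"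

definition relators :: "nat \<Rightarrow> ualg set" where
  "relators n =
    {ugen i * ugen i - scal (Poly_Mapping.single 0 beta) * ugen i | i. i < n}
  \<union> (if 1 < n then {ugen 1 * ugen 0 * ugen 1 * ugen 0 - ugen 0 * ugen 1 * ugen 0 * ugen 1} else {})
  \<union> {ugen i * ugen (i + 1) * ugen i - ugen (i + 1) * ugen i * ugen (i + 1) | i. 0 < i \<and> i + 1 < n}
  \<union> {ugen i * ugen j - ugen j * ugen i | i j. i < n \<and> j < n \<and> \<bar>int i - int j\<bar> > 1}"

text \<open>The two-sided ideal of \<^term>\<open>free_ualg n\<close> generated by the relators; the algebra in
  question is the quotient by it.\<close>

inductive_set rel_ideal :: "nat \<Rightarrow> ualg set" for n where
  zero: "0 \<in> rel_ideal n"
| add: "f \<in> rel_ideal n \<Longrightarrow> g \<in> rel_ideal n \<Longrightarrow> f + g \<in> rel_ideal n"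
| gen: "r \<in> relators n \<Longrightarrow> p \<in> free_ualg n \<Longrightarrow> q \<in> free_ualg n \<Longrightarrow> p * r * q \<in> rel_ideal n"

text \<open>A representative in the free algebra of \<open>u\<^sub>w\<close>; modulo \<^term>\<open>rel_ideal n\<close> it does not depend
  on the reduced word chosen.\<close>

definition u_perm :: "nat \<Rightarrow> (int \<Rightarrow> int) \<Rightarrow> ualg" where
  "u_perm n w = prod_list (map ugen (SOME a. reduced_word n w a))"

subsection \<open>The power series \<open>G\<^sup>C\<^sub>w\<close>\<close>

definition C_factor :: "nat \<Rightarrow> nat \<Rightarrow> ualg" where
  "C_factor n i = prod_list (map (\<lambda>k. 1 + scal (xvar i) * ugen k) (rev [0..<n] @ [0..<n]))"

definition C_prod :: "nat \<Rightarrow> nat \<Rightarrow> ualg" where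
  "C_prod n m = prod_list (map (C_factor n) [1..<Suc m])"

text \<open>The coordinates of an element modulo \<^term>\<open>rel_ideal n\<close> in the basis \<open>u\<^sub>w\<close>.\<close>

definition u_coeffs :: "nat \<Rightarrow> ualg \<Rightarrow> (int \<Rightarrow> int) \<Rightarrow> xpoly" where
  "u_coeffs n f =
    (THE c. (\<forall>w. w \<notin> signed_perms n \<longrightarrow> c w = 0) \<and>
            f - (\<Sum>w\<in>signed_perms n. scal (c w) * u_perm n w) \<in> rel_ideal n)"

text \<open>The infinite product is the coefficientwise limit of the finite products over
  \<open>x\<^sub>1,\<dots>,x\<^sub>m\<close>: the coefficient of a fixed monomial is eventually constant in \<open>m\<close>.\<close>

definition GC :: "nat \<Rightarrow> (int \<Rightarrow> int) \<Rightarrow> xseries" where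
  "GC n w = (\<lambda>\<alpha>. THE c. \<forall>\<^sub>F m in sequentially.
      Poly_Mapping.lookup (u_coeffs n (C_prod n m) w) \<alpha> = c)"

subsection \<open>Shifted set-valued tableaux and \<open>GQ\<close>\<close>

definition strict_partition :: "nat list \<Rightarrow> bool" where
  "strict_partition l \<longleftrightarrow> sorted_wrt (>) l \<and> 0 \<notin> set l"

definition shifted_diagram :: "nat list \<Rightarrow> (nat \<times> nat) set" where
  "shifted_diagram l =
    {(i, j). 1 \<le> i \<and> i \<le> length l \<and> i \<le> j \<and> j \<le> l ! (i - 1) + i - 1}"

definition skew_diagram :: "nat list \<Rightarrow> nat list \<Rightarrow> (nat \<times> nat) set" where
  "skew_diagram \<nu> \<mu> = shifted_diagram \<nu> - shifted_diagram \<mu>"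

text \<open>The order \<open>-1 \<prec> 1 \<prec> -2 \<prec> 2 \<prec> \<dots>\<close> on the nonzero integers.\<close>

definition prec :: "int \<Rightarrow> int \<Rightarrow> bool" where
  "prec a b \<longleftrightarrow> \<bar>a\<bar> < \<bar>b\<bar> \<or> (\<bar>a\<bar> = \<bar>b\<bar> \<and> a < b)"

definition prec_max :: "int set \<Rightarrow> int" where
  "prec_max S = (THE s. s \<in> S \<and> (\<forall>t\<in>S. t = s \<or> prec t s))"

definition prec_min :: "int set \<Rightarrow> int" where
  "prec_min S = (THE s. s \<in> S \<and> (\<forall>t\<in>S. t = s \<or> prec s t))"

text \<open>Fillings are total functions that are empty off the diagram, so that distinct functions
  are distinct fillings.\<close>

definition set_valued_tableaux :: "nat list \<Rightarrow> nat list \<Rightarrow> (nat \<times> nat \<Rightarrow> int set) set" where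
  "set_valued_tableaux \<nu> \<mu> = {T.
     (\<forall>c. c \<notin> skew_diagram \<nu> \<mu> \<longrightarrow> T c = {}) \<and>
     (\<forall>c \<in> skew_diagram \<nu> \<mu>. finite (T c) \<and> T c \<noteq> {} \<and> 0 \<notin> T c) \<and>
     (\<forall>i j. (i, j) \<in> skew_diagram \<nu> \<mu> \<and> (i + 1, j) \<in> skew_diagram \<nu> \<mu> \<longrightarrow>
        (let a = prec_max (T (i, j)); b = prec_min (T (i + 1, j))
         in prec a b \<or> (a = b \<and> a < 0))) \<and>
     (\<forall>i j. (i, j) \<in> skew_diagram \<nu> \<mu> \<and> (i, j + 1) \<in> skew_diagram \<nu> \<mu> \<longrightarrow>
        (let a = prec_max (T (i, j)); b = prec_min (T (i, j + 1))
         in prec a b \<or> (a = b \<and> a > 0)))}"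

definition tableau_size :: "nat list \<Rightarrow> nat list \<Rightarrow> (nat \<times> nat \<Rightarrow> int set) \<Rightarrow> nat" where
  "tableau_size \<nu> \<mu> T = (\<Sum>c\<in>skew_diagram \<nu> \<mu>. card (T c))"

definition tableau_weight :: "nat list \<Rightarrow> nat list \<Rightarrow> (nat \<times> nat \<Rightarrow> int set) \<Rightarrow> monom" where
  "tableau_weight \<nu> \<mu> T =
    (\<Sum>c\<in>skew_diagram \<nu> \<mu>. \<Sum>s\<in>T c. Poly_Mapping.single (nat \<bar>s\<bar>) 1)"

definition GQ :: "nat list \<Rightarrow> nat list \<Rightarrow> xseries" where
  "GQ \<nu> \<mu> = (\<lambda>\<alpha>. \<Sum>T | T \<in> set_valued_tableaux \<nu> \<mu> \<and> tableau_weight \<nu> \<mu> T = \<alpha>.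
      beta ^ (tableau_size \<nu> \<mu> T - card (skew_diagram \<nu> \<mu>)))"

end

theory Submission
  imports Defs
begin

text \<open>
  Number the boxes of a shifted diagram by their diagonals. Letting \<open>u\<^sub>i\<close> add a box on the
  \<open>i\<close>-th diagonal, multiply by \<open>\<beta>\<close> if the last box there is a removable box of the skew shape, and be
  zero otherwise, turns the shapes between \<open>\<mu>\<close> and \<open>\<nu>\<close> into a module over the algebra of the
  \<open>u\<^sub>i\<close>, on which both braid words act as zero. A word takes \<open>\<mu>\<close> to \<open>\<beta>\<^sup>k\<close> times \<open>\<nu>\<close> exactly if
  it represents \<open>\<beta>\<^sup>k u\<^sub>w\<close>, where \<open>w\<close> is the product of the generators read off the boxes of \<open>\<nu>/\<mu>\<close>
  in any order in which they can be added. So \<open>G\<^sup>C\<^sub>w\<close> is the coefficient of \<open>\<nu>\<close> in the image of \<open>\<mu>\<close>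
  under the product of the factors \<open>1 + x\<^sub>k u\<^sub>i\<close>, and recording which factor acts on which box
  yields precisely the set-valued tableaux.

  Coordinates in the basis \<open>u\<^sub>w\<close> are computed with the Demazure product on signed permutations.
\<close>

section \<open>Signed permutations and the Demazure product\<close>

text \<open>\<open>u_coeffs\<close> and \<open>GC\<close> are definite descriptions, so the elements
  u_w must be shown to form a basis. Spanning rests on Matsumoto's theorem; independence comes from
  functionals on words, read off the Demazure product, that respect the relations. No length
  function is used: reduced words are identified with the words along which every letter is an
  ascent.

  The braid words act as zero because a diagonal i > 0 must see a new box on both neighbouring
  diagonals before it can take a second one itself. Hence words that only add boxes and end in the
  same shape differ by commuting letters, which is why w is well defined. That the power of \<beta>
  is the same in the action and in the Demazure product holds because a removable box can be moved
  to the end of the word that built the shape.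

  Corners of \<mu> must not yield \<beta>, since a skew tableau has no entries there. Tableaux are
  matched by peeling off the last factor: a corner of the outer shape either keeps other entries
  when that factor's entry is deleted, which accounts for \<beta>, or becomes empty and leaves the
  shape.\<close>

lemma cox_gen_0: "cox_gen 0 x = (if x = 1 then -1 else if x = -1 then 1 else x)"
  by (auto simp: cox_gen_def transpose_def)

lemma cox_gen_pos:
  "0 < i \<Longrightarrow> cox_gen i x =
    (if x = int i then int i + 1 else if x = int i + 1 then int i
     else if x = - int i then - int i - 1 else if x = - int i - 1 then - int i else x)"
  by (auto simp: cox_gen_def transpose_def)

lemma cox_gen_involution [simp]: "cox_gen i (cox_gen i x) = x"
  by (cases "i = 0") (auto simp: cox_gen_0 cox_gen_pos)

lemma comp_cox_gen_cancel [simp]: "w \<circ> cox_gen i \<circ> cox_gen i = w"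
  by (auto simp: fun_eq_iff)

lemma signed_permsD:
  assumes "w \<in> signed_perms n"
  shows "w 0 = 0" "w (- x) = - w x" "w x = w y \<longleftrightarrow> x = y" "w x = 0 \<longleftrightarrow> x = 0"
    "w x = - w y \<longleftrightarrow> x = - y"
proof -
  have odd: "w (- x) = - w x" for x
    using assms by (auto simp: signed_perms_def)
  have inj: "w x = w y \<longleftrightarrow> x = y" for x y
    using assms by (auto simp: signed_perms_def inj_eq[OF permutes_inj])
  show 0: "w 0 = 0" using odd[of 0] by simp
  show "w (- x) = - w x" "w x = w y \<longleftrightarrow> x = y" by (fact odd inj)+
  show "w x = 0 \<longleftrightarrow> x = 0" using inj[of x 0] 0 by simp
  show "w x = - w y \<longleftrightarrow> x = - y" using inj[of x "-y"] odd[of y] by simp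
qed

lemma id_signed_perms: "id \<in> signed_perms n"
  by (simp add: signed_perms_def permutes_id)

lemma cox_gen_signed_perms:
  assumes "i < n"
  shows "cox_gen i \<in> signed_perms n"
proof -
  have "\<exists>!x. cox_gen i x = y" for y
    by (metis cox_gen_involution)
  moreover have "cox_gen i x = x" if "x \<notin> {- int n..int n} - {0}" for x
    using that assms by (cases "i = 0") (auto simp: cox_gen_0 cox_gen_pos)
  moreover have "cox_gen i (- x) = - cox_gen i x" for x
    by (cases "i = 0") (auto simp: cox_gen_0 cox_gen_pos)
  ultimately show ?thesis
    by (auto simp: signed_perms_def permutes_def)
qed

lemma comp_signed_perms:
  "v \<in> signed_perms n \<Longrightarrow> w \<in> signed_perms n \<Longrightarrow> v \<circ> w \<in> signed_perms n"
  by (auto simp: signed_perms_def intro: permutes_compose)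

lemma finite_signed_perms: "finite (signed_perms n)"
  by (rule finite_subset[OF _ finite_permutations[of "{- int n..int n} - {0}"]])
    (auto simp: signed_perms_def)

lemma word_perm_Nil [simp]: "word_perm [] = id"
  by (simp add: word_perm_def)

lemma word_perm_snoc [simp]: "word_perm (a @ [i]) = word_perm a \<circ> cox_gen i"
proof (induction a)
  case (Cons j a)
  then show ?case by (simp add: word_perm_def comp_assoc)
qed (simp add: word_perm_def)

lemma word_perm_signed_perms:
  "set a \<subseteq> {..<n} \<Longrightarrow> word_perm a \<in> signed_perms n"
  by (induction a rule: rev_induct)
    (auto intro: id_signed_perms comp_signed_perms cox_gen_signed_perms)

lemma cox_gen_fix:
  "x \<notin> {int i, int i + 1, - int i, - int i - 1} \<Longrightarrow> cox_gen i x = x"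
  by (cases "i = 0") (auto simp: cox_gen_0 cox_gen_pos)

lemma cox_gen_odd: "cox_gen i (- x) = - cox_gen i x"
  by (cases "i = 0") (auto simp: cox_gen_0 cox_gen_pos)

text \<open>The points moved by one generator are permuted among themselves and fixed by the other;
  the gap between the indices makes the two sets of moved points disjoint.\<close>

lemma cox_gen_commute_less:
  assumes "int i + 1 < int j"
  shows "cox_gen i (cox_gen j x) = cox_gen j (cox_gen i x)"
proof (cases "x \<in> {int i, int i + 1, - int i, - int i - 1}")
  case True
  then have "cox_gen i x \<in> {int i, int i + 1, - int i, - int i - 1}"
    by (cases "i = 0") (auto simp: cox_gen_0 cox_gen_pos)
  with True show ?thesis
    using assms by (auto simp: cox_gen_fix)
next
  case False
  have "cox_gen j x \<notin> {int i, int i + 1, - int i, - int i - 1}"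
  proof (cases "x \<in> {int j, int j + 1, - int j, - int j - 1}")
    case True
    then have "cox_gen j x \<in> {int j, int j + 1, - int j, - int j - 1}"
      using assms by (auto simp: cox_gen_pos)
    then show ?thesis using assms by auto
  next
    case False': False
    then show ?thesis using False by (simp only: cox_gen_fix not_False_eq_True)
  qed
  then show ?thesis
    using False by (simp only: cox_gen_fix not_False_eq_True)
qed

lemma cox_gen_commute:
  "\<bar>int i - int j\<bar> > 1 \<Longrightarrow> cox_gen i (cox_gen j x) = cox_gen j (cox_gen i x)"
  using cox_gen_commute_less[of i j x] cox_gen_commute_less[of j i x] by linarith

lemma cox_gen_at: "cox_gen i (int i) = (if i = 0 then 0 else int i + 1)"
  "cox_gen i (int i + 1) = (if i = 0 then - 1 else int i)"
  by (auto simp: cox_gen_0 cox_gen_pos)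

lemma cox_gen_braid3:
  assumes "0 < i"
  shows "cox_gen i (cox_gen (Suc i) (cox_gen i x)) = cox_gen (Suc i) (cox_gen i (cox_gen (Suc i) x))"
proof -
  have v: "cox_gen i (int i) = int i + 1" "cox_gen i (int i + 1) = int i"
    using assms by (simp_all add: cox_gen_at)
  have v': "cox_gen (Suc i) (int i + 1) = int i + 2" "cox_gen (Suc i) (int i + 2) = int i + 1"
    using cox_gen_at[of "Suc i"] by (simp_all add: algebra_simps)
  have v'': "cox_gen i (int i + 2) = int i + 2" "cox_gen (Suc i) (int i) = int i"
    using assms by (auto intro!: cox_gen_fix)
  \<comment> \<open>Generators are odd, so nonnegative arguments suffice, and only three of these
    are moved.\<close>
  have *: "cox_gen i (cox_gen (Suc i) (cox_gen i x)) = cox_gen (Suc i) (cox_gen i (cox_gen (Suc i) x))"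
    if "0 \<le> x" for x
  proof (cases "x \<in> {int i, int i + 1, int i + 2}")
    case True
    then show ?thesis
      by (elim insertE emptyE) (simp_all only: v v' v'')
  next
    case False
    then have "cox_gen i x = x" "cox_gen (Suc i) x = x"
      using that assms by (auto intro!: cox_gen_fix)
    then show ?thesis by simp
  qed
  show ?thesis
  proof (cases "0 \<le> x")
    case False
    then have "0 \<le> - x" by simp
    from *[OF this] show ?thesis
      by (simp only: cox_gen_odd neg_equal_iff_equal)
  qed (rule *)
qed

lemma cox_gen_braid4:
  "cox_gen (Suc 0) (cox_gen 0 (cox_gen (Suc 0) (cox_gen 0 x)))
    = cox_gen 0 (cox_gen (Suc 0) (cox_gen 0 (cox_gen (Suc 0) x)))"
proof (cases "x \<in> {1, 2, - 1, - 2}")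
  case True
  have v: "cox_gen 0 1 = -1" "cox_gen 0 (-1) = 1" "cox_gen 0 2 = 2" "cox_gen 0 (-2) = -2"
    "cox_gen (Suc 0) 1 = 2" "cox_gen (Suc 0) 2 = 1" "cox_gen (Suc 0) (-1) = -2" "cox_gen (Suc 0) (-2) = -1"
    by (simp_all add: cox_gen_0 cox_gen_pos)
  from True show ?thesis
    by (elim insertE emptyE) (simp_all only: v)
next
  case False
  then have "cox_gen (Suc 0) x = x" "cox_gen 0 x = x"
    by (auto simp: cox_gen_0 cox_gen_pos)
  then show ?thesis by simp
qed

text \<open>Every signed permutation fixes \<open>0\<close>, so the case \<open>i = 0\<close> reads \<open>w 1 < 0\<close>.\<close>

definition descent :: "nat \<Rightarrow> (int \<Rightarrow> int) \<Rightarrow> bool" where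
  "descent i w \<longleftrightarrow> w (int i + 1) < w (int i)"

text \<open>The pair \<open>(k, w)\<close> stands for \<open>\<beta>\<^sup>k u\<^sub>w\<close>, which is multiplied by \<open>u\<^sub>i\<close> on the right.\<close>

definition dstep :: "nat \<times> (int \<Rightarrow> int) \<Rightarrow> nat \<Rightarrow> nat \<times> (int \<Rightarrow> int)" where
  "dstep p i = (if descent i (snd p) then (Suc (fst p), snd p) else (fst p, snd p \<circ> cox_gen i))"

abbreviation demazure :: "nat \<times> (int \<Rightarrow> int) \<Rightarrow> nat list \<Rightarrow> nat \<times> (int \<Rightarrow> int)" where
  "demazure \<equiv> foldl dstep"

text \<open>The generator swaps the two compared values; for i = 0 it changes the sign of w
  1.\<close>

lemma descent_comp_cox_gen:
  assumes "w \<in> signed_perms n"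
  shows "descent i (w \<circ> cox_gen i) \<longleftrightarrow> \<not> descent i w"
proof (cases "i = 0")
  case True
  have "w 1 \<noteq> 0" "w (- 1) = - w 1" "w 0 = 0"
    by (simp_all add: signed_permsD[OF assms])
  then show ?thesis
    using True by (auto simp: descent_def cox_gen_0)
next
  case False
  have "w (int i) \<noteq> w (int i + 1)"
    by (simp add: signed_permsD[OF assms])
  then show ?thesis
    using False by (auto simp: descent_def cox_gen_at)
qed

lemma demazure_shift:
  "demazure (k + d, w) a = (fst (demazure (k, w) a) + d, snd (demazure (k, w) a))"
  by (induction a rule: rev_induct) (auto simp: dstep_def)

lemma demazure_signed_perms:
  "w \<in> signed_perms n \<Longrightarrow> set a \<subseteq> {..<n} \<Longrightarrow> snd (demazure (k, w) a) \<in> signed_perms n"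
  by (induction a rule: rev_induct)
    (auto simp: dstep_def intro: comp_signed_perms cox_gen_signed_perms)

text \<open>The move from \<open>r\<close> to \<open>s\<close> with exponent \<open>d\<close> encodes the relation \<open>u\<^sub>r = \<beta>\<^sup>d u\<^sub>s\<close>.\<close>

inductive hecke_move :: "nat \<Rightarrow> nat list \<Rightarrow> nat list \<Rightarrow> nat \<Rightarrow> bool" for n where
  quadratic: "i < n \<Longrightarrow> hecke_move n [i, i] [i] 1"
| braid4: "1 < n \<Longrightarrow> hecke_move n [1, 0, 1, 0] [0, 1, 0, 1] 0"
| braid3: "0 < i \<Longrightarrow> i + 1 < n \<Longrightarrow> hecke_move n [i, i + 1, i] [i + 1, i, i + 1] 0"
| commute: "i < n \<Longrightarrow> j < n \<Longrightarrow> \<bar>int i - int j\<bar> > 1 \<Longrightarrow> hecke_move n [i, j] [j, i] 0"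

text \<open>This makes the pairs (k, w) a right module for the relations. For the braid relations,
  the relative order of the two or three values involved, with their signs when 0 is a letter,
  decides every descent test on both sides.\<close>

lemma demazure_hecke_move:
  assumes "hecke_move n r s d" "w \<in> signed_perms n"
  shows "demazure (k, w) r = demazure (k + d, w) s"
  using assms(1)
proof cases
  case (quadratic i)
  then show ?thesis
    using descent_comp_cox_gen[OF assms(2)] by (simp add: dstep_def)
next
  case braid4
  have *: "w 1 \<noteq> 0" "w 2 \<noteq> 0" "w 1 \<noteq> w 2" "w 1 \<noteq> - w 2" "w (-1) = - w 1" "w (-2) = - w 2" "w 0 = 0"
    by (simp_all add: signed_permsD[OF assms(2)])
  have c: "cox_gen 0 0 = 0" "cox_gen 0 1 = -1" "cox_gen 0 (-1) = 1" "cox_gen 0 2 = 2" "cox_gen 0 (-2) = -2"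
    "cox_gen (Suc 0) 0 = 0" "cox_gen (Suc 0) 1 = 2" "cox_gen (Suc 0) 2 = 1"
    "cox_gen (Suc 0) (-1) = -2" "cox_gen (Suc 0) (-2) = -1"
    by (simp_all add: cox_gen_0 cox_gen_pos)
  have "w \<circ> cox_gen (Suc 0) \<circ> cox_gen 0 \<circ> cox_gen (Suc 0) \<circ> cox_gen 0
      = w \<circ> cox_gen 0 \<circ> cox_gen (Suc 0) \<circ> cox_gen 0 \<circ> cox_gen (Suc 0)"
    by (simp add: fun_eq_iff cox_gen_braid4)
  with * show ?thesis
    unfolding braid4
    by (cases "w 1 < 0"; cases "w 2 < 0"; cases "w 1 < w 2"; cases "w 1 < - w 2")
      (simp_all add: dstep_def descent_def c)
next
  case (braid3 i)
  have *: "w (int i) \<noteq> w (int i + 1)" "w (int i) \<noteq> w (int i + 2)" "w (int i + 1) \<noteq> w (int i + 2)"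
    by (simp_all add: signed_permsD[OF assms(2)])
  have c: "cox_gen i (int i) = int i + 1" "cox_gen i (int i + 1) = int i" "cox_gen i (int i + 2) = int i + 2"
    "cox_gen (Suc i) (int i) = int i" "cox_gen (Suc i) (int i + 1) = int i + 2"
    "cox_gen (Suc i) (int i + 2) = int i + 1" "1 + int i = int i + 1" "int i + 1 + 1 = int i + 2"
    using braid3 by (simp_all add: cox_gen_pos)
  have "w \<circ> cox_gen i \<circ> cox_gen (Suc i) \<circ> cox_gen i = w \<circ> cox_gen (Suc i) \<circ> cox_gen i \<circ> cox_gen (Suc i)"
    using braid3 by (simp add: fun_eq_iff cox_gen_braid3)
  with * show ?thesis
    unfolding braid3
    by (cases "w (int i) < w (int i + 1)"; cases "w (int i) < w (int i + 2)";
        cases "w (int i + 1) < w (int i + 2)")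
      (simp_all add: dstep_def descent_def c)
next
  case (commute i j)
  have "descent i (w \<circ> cox_gen j) = descent i w" "descent j (w \<circ> cox_gen i) = descent j w"
    using commute by (cases "i = 0"; cases "j = 0"; auto simp: descent_def cox_gen_0 cox_gen_pos)+
  then show ?thesis
    using commute by (simp add: dstep_def fun_eq_iff cox_gen_commute)
qed

section \<open>Reduced words and the Hecke relations\<close>

text \<open>The pair (k, a) stands for \<beta>^k u_a. Keeping the congruence on words lets the
  Demazure product, the ideal and the action on shapes each be checked on single moves.\<close>

inductive hecke_eq :: "nat \<Rightarrow> nat \<times> nat list \<Rightarrow> nat \<times> nat list \<Rightarrow> bool" for n where
  hecke_refl: "hecke_eq n p p"
| hecke_sym: "hecke_eq n p q \<Longrightarrow> hecke_eq n q p"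
| hecke_trans: "hecke_eq n p q \<Longrightarrow> hecke_eq n q r \<Longrightarrow> hecke_eq n p r"
| hecke_step: "hecke_move n r s d \<Longrightarrow> set a \<subseteq> {..<n} \<Longrightarrow> set b \<subseteq> {..<n} \<Longrightarrow>
    hecke_eq n (k, a @ r @ b) (k + d, a @ s @ b)"

lemma hecke_eq_append:
  "hecke_eq n p q \<Longrightarrow> set c \<subseteq> {..<n} \<Longrightarrow> hecke_eq n (fst p, snd p @ c) (fst q, snd q @ c)"
proof (induction rule: hecke_eq.induct)
  case (hecke_step r s d a b k)
  then show ?case using hecke_eq.hecke_step[of n r s d a "b @ c" k] by simp
qed (auto intro: hecke_eq.intros)

lemma hecke_eq_shift:
  "hecke_eq n p q \<Longrightarrow> hecke_eq n (fst p + m, snd p) (fst q + m, snd q)"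
proof (induction rule: hecke_eq.induct)
  case (hecke_step r s d a b k)
  then show ?case using hecke_eq.hecke_step[of n r s d a b "k + m"] by (simp add: ac_simps)
qed (auto intro: hecke_eq.intros)

text \<open>The quadratic move trades one letter for one factor \<beta>; the other moves preserve
  the length.\<close>

lemma hecke_eq_degree:
  "hecke_eq n p q \<Longrightarrow> fst p + length (snd p) = fst q + length (snd q)"
  by (induction rule: hecke_eq.induct) (auto elim: hecke_move.cases)

lemma hecke_eq_demazure:
  "hecke_eq n p q \<Longrightarrow> demazure (fst p, id) (snd p) = demazure (fst q, id) (snd q)"
proof (induction rule: hecke_eq.induct)
  case (hecke_step r s d a b k)
  obtain k' v where v: "demazure (k, id) a = (k', v)"
    by fastforce
  then have "v \<in> signed_perms n"
    using demazure_signed_perms[OF id_signed_perms, of a n k] hecke_step by simp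
  from demazure_hecke_move[OF hecke_step(1) this, of k'] have "demazure (demazure (k, id) a) r = demazure (demazure (k + d, id) a) s"
    by (simp only: v demazure_shift fst_conv snd_conv)
  then show ?case
    by (simp only: foldl_append fst_conv snd_conv)
qed simp_all

text \<open>Exponent 0 says that no letter meets a descent. This turns out to be reducedness
  (\<open>reduced_word_iff_dem_word\<close>), in a form that passes to prefixes and suits induction
  on the last letter.\<close>

definition dem_word :: "nat \<Rightarrow> (int \<Rightarrow> int) \<Rightarrow> nat list \<Rightarrow> bool" where
  "dem_word n w a \<longleftrightarrow> set a \<subseteq> {..<n} \<and> demazure (0, id) a = (0, w)"

lemma dem_word_signed_perms: "dem_word n w a \<Longrightarrow> w \<in> signed_perms n"
  using demazure_signed_perms[OF id_signed_perms, of a n 0] by (simp add: dem_word_def)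

lemma dem_word_snoc:
  "dem_word n w a \<Longrightarrow> i < n \<Longrightarrow> \<not> descent i w \<Longrightarrow> dem_word n (w \<circ> cox_gen i) (a @ [i])"
  by (simp add: dem_word_def dstep_def)

lemma dem_word_descent:
  assumes "dem_word n (w \<circ> cox_gen i) a" "i < n" "descent i w" "w \<in> signed_perms n"
  shows "dem_word n w (a @ [i])"
  using dem_word_snoc[OF assms(1,2)] assms(3) descent_comp_cox_gen[OF assms(4)] by simp

lemma dem_word_snocD:
  assumes "dem_word n w (a @ [i])"
  shows "i < n" "descent i w" "dem_word n (w \<circ> cox_gen i) a"
proof -
  obtain k v where v: "demazure (0, id) a = (k, v)"
    by fastforce
  have i: "i < n" "set a \<subseteq> {..<n}"
    using assms by (auto simp: dem_word_def)
  have *: "\<not> descent i v" "k = 0" "w = v \<circ> cox_gen i"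
    using assms v by (auto simp: dem_word_def dstep_def split: if_splits)
  have "v \<in> signed_perms n"
    using demazure_signed_perms[OF id_signed_perms i(2), of 0] v by simp
  then show "i < n" "descent i w" "dem_word n (w \<circ> cox_gen i) a"
    using * i v by (auto simp: descent_comp_cox_gen dem_word_def)
qed

lemma not_descent_id: "\<not> descent i id"
  by (simp add: descent_def)

lemma dem_word_id: "dem_word n id a \<longleftrightarrow> a = []"
  by (cases a rule: rev_cases) (auto simp: not_descent_id dest: dem_word_snocD, simp add: dem_word_def)

lemma dem_word_perm: "dem_word n w a \<Longrightarrow> word_perm a = w"
proof (induction a arbitrary: w rule: rev_induct)
  case Nil
  then show ?case by (simp add: dem_word_def)
next
  case (snoc i a)
  then show ?case using dem_word_snocD[OF snoc.prems] by simp
qed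

section \<open>Existence of words of ascents\<close>

lemma signed_perms_bound:
  assumes "w \<in> signed_perms n" "\<bar>x\<bar> \<le> int n"
  shows "\<bar>w x\<bar> \<le> int n"
proof (cases "x = 0")
  case False
  then have "x \<in> {- int n..int n} - {0}"
    using assms(2) by auto
  then have "w x \<in> {- int n..int n} - {0}"
    using assms(1) permutes_in_image[of w "{- int n..int n} - {0}" x] by (simp add: signed_perms_def)
  then show ?thesis by auto
qed (simp add: signed_permsD[OF assms(1)])

text \<open>Without descents 0 = w 0 < w 1 < ... < w n \<le> n, which leaves no room for
  gaps.\<close>

lemma no_descent_imp_id:
  assumes w: "w \<in> signed_perms n" and nd: "\<And>i. i < n \<Longrightarrow> \<not> descent i w"
  shows "w = id"
proof -
  have lt: "w (int i) < w (int i + 1)" if "i < n" for i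
  proof -
    have "w (int i) \<noteq> w (int i + 1)"
      by (simp add: signed_permsD[OF w])
    then show ?thesis
      using nd[OF that] by (simp add: descent_def)
  qed
  have lower: "int i \<le> w (int i)" if "i \<le> n" for i
    using that
  proof (induction i)
    case 0
    then show ?case by (simp add: signed_permsD[OF w])
  next
    case (Suc i)
    then show ?case using lt[of i] by (simp add: add.commute)
  qed
  have upper: "w (int i) \<le> int i" if "i \<le> n" for i
    using that
  proof (induction i rule: inc_induct)
    case base
    then show ?case using signed_perms_bound[OF w, of "int n"] by simp
  next
    case (step i)
    then show ?case using lt[of i] by (simp add: add.commute)
  qed
  have nat: "w (int i) = int i" for i
  proof (cases "i \<le> n")
    case True
    then show ?thesis using lower[of i] upper[of i] by simp
  next
    case False
    then show ?thesis
      using w by (auto simp: signed_perms_def permutes_def)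
  qed
  have "w x = x" for x
    using nat[of "nat x"] nat[of "nat (- x)"] signed_permsD(2)[OF w, of "- x"]
    by (cases "0 \<le> x") simp_all
  then show ?thesis by auto
qed

text \<open>A measure in place of the length: exchanging the values at i and i + 1 adds w i - w (i +
  1) to the weighted sum, and for i = 0 the sign change of w 1 adds -2 * w 1. Both are positive at a
  descent.\<close>

lemma descent_weight_increase:
  assumes w: "w \<in> signed_perms n" and "i < n" "descent i w"
  shows "(\<Sum>k = 1..n. int k * w (int k)) < (\<Sum>k = 1..n. int k * (w \<circ> cox_gen i) (int k))"
proof -
  let ?d = "\<lambda>k. int k * ((w \<circ> cox_gen i) (int k) - w (int k))"
  have "(\<Sum>k = 1..n. ?d k) = (\<Sum>k \<in> {i, Suc i} - {0}. ?d k)"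
    using \<open>i < n\<close>
    by (intro sum.mono_neutral_right) (auto intro!: cox_gen_fix arg_cong[of _ _ w])
  also have "\<dots> > 0"
  proof (cases "i = 0")
    case True
    have "{i, Suc i} - {0} = {Suc 0}" using True by auto
    moreover have "w 1 < 0" "w (- 1) = - w 1"
      using assms(3) True signed_permsD(1,2)[OF w] by (auto simp: descent_def)
    ultimately show ?thesis using True by (simp add: cox_gen_0)
  next
    case False
    then have *: "{i, Suc i} - {0} = {i, Suc i}" by auto
    show ?thesis
      using assms(3) False cox_gen_at[of i]
      by (simp add: * descent_def add.commute algebra_simps)
  qed
  finally show ?thesis
    by (simp add: right_diff_distrib sum_subtractf)
qed

lemma exists_dem_word:
  assumes "w \<in> signed_perms n"
  shows "\<exists>a. dem_word n w a"
  using assms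
\<comment> \<open>The weighted sum has n terms of size at most n * n, so n^3 bounds it and the
  difference decreases as a natural number.\<close>
proof (induction "nat (int n * int n * int n - (\<Sum>k = 1..n. int k * w (int k)))"
    arbitrary: w rule: less_induct)
  case less
  show ?case
  proof (cases "\<exists>i<n. descent i w")
    case True
    then obtain i where i: "i < n" "descent i w" by auto
    define v where "v = w \<circ> cox_gen i"
    have v: "v \<in> signed_perms n"
      using less.prems i by (simp add: v_def comp_signed_perms cox_gen_signed_perms)
    have "(\<Sum>k = 1..n. int k * v (int k)) \<le> (\<Sum>k = 1..n. int n * int n)"
    proof (rule sum_mono)
      fix k assume k: "k \<in> {1..n}"
      then have "v (int k) \<le> int n"
        using signed_perms_bound[OF v, of "int k"] by simp
      then have "int k * v (int k) \<le> int k * int n"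
        by (simp add: mult_left_mono)
      also have "\<dots> \<le> int n * int n"
        using k by (intro mult_right_mono) auto
      finally show "int k * v (int k) \<le> int n * int n" .
    qed
    then have "(\<Sum>k = 1..n. int k * v (int k)) \<le> int n * int n * int n"
      by simp
    then obtain a where "dem_word n v a"
      using less.hyps[OF _ v] descent_weight_increase[OF less.prems i] by (auto simp: v_def)
    then show ?thesis
      using dem_word_descent[of n w i a] i less.prems by (auto simp: v_def)
  next
    case False
    then have "w = id"
      using no_descent_imp_id[OF less.prems] by auto
    then show ?thesis
      using dem_word_id by auto
  qed
qed

section \<open>Two descents and Matsumoto's theorem\<close>

lemma dstep_descent:
  "w \<in> signed_perms n \<Longrightarrow> descent i w \<Longrightarrow> dstep (k, w \<circ> cox_gen i) i = (k, w)"
  by (simp add: dstep_def descent_comp_cox_gen)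

text \<open>Two descents put w at the top of its coset under the two generators. Undoing the whole
  braid word that ends in i leads to v, and every step back starts at a descent; so this word climbs
  from v to w without \<beta>, and by the relation the other braid word does too.\<close>

lemma descent_pair_less:
  assumes w: "w \<in> signed_perms n" and ij: "i < j" "j < n" and d: "descent i w" "descent j w"
  shows "\<exists>v x y. v \<in> signed_perms n \<and> set x \<union> set y \<subseteq> {..<n} \<and> demazure (0, v) (x @ [i]) = (0, w)
    \<and> demazure (0, v) (y @ [j]) = (0, w)
    \<and> (hecke_move n (x @ [i]) (y @ [j]) 0 \<or> hecke_move n (y @ [j]) (x @ [i]) 0)"
proof -
  have cl: "u \<circ> cox_gen k \<in> signed_perms n" if "u \<in> signed_perms n" "k < n" for u k
    using that by (simp add: comp_signed_perms cox_gen_signed_perms)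
  have wi: "w \<circ> cox_gen i \<in> signed_perms n"
    using cl[OF w] ij by simp
  have wij: "w \<circ> cox_gen i \<circ> cox_gen j \<in> signed_perms n"
    using cl[OF wi] ij by simp
  have wiji: "w \<circ> cox_gen i \<circ> cox_gen j \<circ> cox_gen i \<in> signed_perms n"
    using cl[OF wij] ij by simp
  have wijij: "w \<circ> cox_gen i \<circ> cox_gen j \<circ> cox_gen i \<circ> cox_gen j \<in> signed_perms n"
    using cl[OF wiji] ij by simp
  consider "j > i + 1" | "j = Suc i" "0 < i" | "i = 0" "j = Suc 0"
    using ij by linarith
  then show ?thesis
  proof cases
    case 1
    have "descent j (w \<circ> cox_gen i)"
      using d(2) 1 by (simp add: descent_def cox_gen_fix)
    then have "demazure (0, w \<circ> cox_gen i \<circ> cox_gen j) ([j] @ [i]) = (0, w)"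
      using d by (simp add: dstep_descent[OF w] dstep_descent[OF wi])
    moreover have m: "hecke_move n ([j] @ [i]) ([i] @ [j]) 0"
      using hecke_move.commute[of j n i] 1 ij by simp
    ultimately show ?thesis
      using demazure_hecke_move[OF m wij, of 0] wij ij
      by (intro exI[of _ "w \<circ> cox_gen i \<circ> cox_gen j"] exI[of _ "[j]"] exI[of _ "[i]"]) simp
  next
    case 2
    have v: "cox_gen i (int i) = int i + 1" "cox_gen i (int i + 1) = int i"
      using 2 by (simp_all add: cox_gen_at)
    have v': "cox_gen (Suc i) (int i + 1) = int i + 2"
      using cox_gen_at[of "Suc i"] by (simp add: algebra_simps)
    have v'': "cox_gen i (int i + 2) = int i + 2" "cox_gen (Suc i) (int i) = int i"
      using 2 by (auto intro!: cox_gen_fix)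
    have j: "int j = int i + 1" "int i + 1 + 1 = int i + 2"
      using 2 by simp_all
    have "w (int i + 1) < w (int i)" "w (int i + 2) < w (int i + 1)"
      using d by (simp_all only: descent_def j)
    then have "descent j (w \<circ> cox_gen i)" "descent i (w \<circ> cox_gen i \<circ> cox_gen j)"
      unfolding 2(1) descent_def comp_apply j(1)[unfolded 2(1)] j(2) v v' v'' by simp_all
    then have "demazure (0, w \<circ> cox_gen i \<circ> cox_gen j \<circ> cox_gen i) ([i, j] @ [i]) = (0, w)"
      using d by (simp add: dstep_descent[OF w] dstep_descent[OF wi] dstep_descent[OF wij])
    moreover have m: "hecke_move n ([i, j] @ [i]) ([j, i] @ [j]) 0"
      using hecke_move.braid3[of i n] 2 ij by simp
    ultimately show ?thesis
      using demazure_hecke_move[OF m wiji, of 0] wiji ij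
      by (intro exI[of _ "w \<circ> cox_gen i \<circ> cox_gen j \<circ> cox_gen i"] exI[of _ "[i, j]"] exI[of _ "[j, i]"]) simp
  next
    case 3
    have v: "cox_gen 0 0 = 0" "cox_gen 0 1 = -1" "cox_gen 0 (-1) = 1" "cox_gen 0 2 = 2" "cox_gen 0 (-2) = -2"
      "cox_gen (Suc 0) 0 = 0" "cox_gen (Suc 0) 1 = 2" "cox_gen (Suc 0) 2 = 1"
      "cox_gen (Suc 0) (-1) = -2" "cox_gen (Suc 0) (-2) = -1"
      by (simp_all add: cox_gen_0 cox_gen_pos)
    have "w (-1) = - w 1" "w (-2) = - w 2" "w 0 = 0"
      by (simp_all add: signed_permsD[OF w])
    then have "descent j (w \<circ> cox_gen i)" "descent i (w \<circ> cox_gen i \<circ> cox_gen j)"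
      "descent j (w \<circ> cox_gen i \<circ> cox_gen j \<circ> cox_gen i)"
      using d 3 by (auto simp: descent_def v)
    then have "demazure (0, w \<circ> cox_gen i \<circ> cox_gen j \<circ> cox_gen i \<circ> cox_gen j) ([j, i, j] @ [i]) = (0, w)"
      using d by (simp add: dstep_descent[OF w] dstep_descent[OF wi] dstep_descent[OF wij] dstep_descent[OF wiji])
    moreover have m: "hecke_move n ([j, i, j] @ [i]) ([i, j, i] @ [j]) 0"
      using hecke_move.braid4[of n] 3 ij by simp
    ultimately show ?thesis
      using demazure_hecke_move[OF m wijij, of 0] wijij ij
      by (intro exI[of _ "w \<circ> cox_gen i \<circ> cox_gen j \<circ> cox_gen i \<circ> cox_gen j"]
          exI[of _ "[j, i, j]"] exI[of _ "[i, j, i]"]) simp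
  qed
qed

lemma descent_pair:
  assumes "w \<in> signed_perms n" "i < n" "j < n" "i \<noteq> j" "descent i w" "descent j w"
  obtains v x y where "v \<in> signed_perms n" "set x \<subseteq> {..<n}" "set y \<subseteq> {..<n}"
    "demazure (0, v) (x @ [i]) = (0, w)" "demazure (0, v) (y @ [j]) = (0, w)"
    "hecke_move n (x @ [i]) (y @ [j]) 0 \<or> hecke_move n (y @ [j]) (x @ [i]) 0"
proof (cases "i < j")
  case True
  with descent_pair_less[of w n i j] assms that show thesis by auto
next
  case False
  with descent_pair_less[of w n j i] assms that show thesis by auto
qed

text \<open>Matsumoto's theorem for the hyperoctahedral group.\<close>

lemma dem_word_hecke_eq:
  "dem_word n w a \<Longrightarrow> dem_word n w b \<Longrightarrow> hecke_eq n (0, a) (0, b)"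
proof (induction "length a" arbitrary: w a b rule: less_induct)
  case less
  show ?case
  proof (cases a rule: rev_cases)
    case Nil
    then have "w = id" using less.prems(1) by (simp add: dem_word_def)
    then show ?thesis
      using Nil less.prems(2) dem_word_id by (auto intro: hecke_eq.hecke_refl)
  next
    case a: (snoc a' i)
    have "b \<noteq> []"
    proof
      assume "b = []"
      then have "w = id" using less.prems(2) by (simp add: dem_word_def)
      then show False using less.prems(1) dem_word_id a by (metis append_is_Nil_conv not_Cons_self2)
    qed
    then obtain b' j where b: "b = b' @ [j]"
      by (cases b rule: rev_cases) auto
    note A = dem_word_snocD[OF less.prems(1)[unfolded a]]
    note B = dem_word_snocD[OF less.prems(2)[unfolded b]]
    have w: "w \<in> signed_perms n"
      using less.prems(1) by (rule dem_word_signed_perms)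
    have app: "hecke_eq n (0, x @ [k]) (0, y @ [k])" if "hecke_eq n (0, x) (0, y)" "k < n" for x y k
      using hecke_eq_append[OF that(1), of "[k]"] that(2) by simp
    show ?thesis
    proof (cases "i = j")
      case True
      then show ?thesis
        using app[of a' b' i] less.hyps[of a' "w \<circ> cox_gen i" b'] A B a b by simp
    next
      case False
      \<comment> \<open>The path from a to b: rewrite \<open>a'\<close> into \<open>c @ x\<close>,
        apply one braid or commutation move at the end, then rewrite \<open>c @ y\<close> into
        \<open>b'\<close>.\<close>
      obtain v x y where v: "v \<in> signed_perms n" "set x \<subseteq> {..<n}" "set y \<subseteq> {..<n}"
        "demazure (0, v) (x @ [i]) = (0, w)" "demazure (0, v) (y @ [j]) = (0, w)"
        "hecke_move n (x @ [i]) (y @ [j]) 0 \<or> hecke_move n (y @ [j]) (x @ [i]) 0"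
        using descent_pair[OF w A(1) B(1) False A(2) B(2)] by blast
      obtain c where c: "dem_word n v c"
        using exists_dem_word[OF v(1)] by auto
      have cx: "dem_word n w ((c @ x) @ [i])" and cy: "dem_word n w ((c @ y) @ [j])"
        using c v A(1) B(1) by (auto simp: dem_word_def)
      have xy: "hecke_eq n (0, (c @ x) @ [i]) (0, (c @ y) @ [j])"
        using v(6) hecke_eq.hecke_step[of n "x @ [i]" "y @ [j]" 0 c "[]" 0]
          hecke_eq.hecke_sym[OF hecke_eq.hecke_step[of n "y @ [j]" "x @ [i]" 0 c "[]" 0]] c
        by (auto simp: dem_word_def)
      have ax: "hecke_eq n (0, a') (0, c @ x)"
        using less.hyps[of a' "w \<circ> cox_gen i" "c @ x"] A dem_word_snocD[OF cx] a by simp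
      \<comment> \<open>The induction is on the length of the first word, so this second use of the
        hypothesis needs its length, known through the degree.\<close>
      have "length (c @ y) = length a'"
        using hecke_eq_degree[OF xy] hecke_eq_degree[OF ax] by simp
      then have by': "hecke_eq n (0, c @ y) (0, b')"
        using less.hyps[of "c @ y" "w \<circ> cox_gen j" b'] B dem_word_snocD[OF cy] a by simp
      show ?thesis
        using hecke_eq.hecke_trans[OF hecke_eq.hecke_trans[OF app[OF ax A(1)] xy] app[OF by' B(1)]] a b by simp
    qed
  qed
qed

section \<open>Words of ascents are the reduced words\<close>

lemma dem_word_length_eq: "dem_word n w a \<Longrightarrow> dem_word n w b \<Longrightarrow> length a = length b"
  using hecke_eq_degree[OF dem_word_hecke_eq[of n w a b]] by simp

text \<open>Appending a letter to any word changes the length of the ascent words of its product by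
  exactly one, up or down.\<close>

lemma dem_word_length_le:
  "dem_word n w a \<Longrightarrow> set b \<subseteq> {..<n} \<Longrightarrow> word_perm b = w \<Longrightarrow> length a \<le> length b"
proof (induction b arbitrary: w a rule: rev_induct)
  case Nil
  then show ?case using dem_word_id by (metis le_refl word_perm_Nil)
next
  case (snoc i b)
  define v where "v = word_perm b"
  have i: "i < n" "set b \<subseteq> {..<n}"
    using snoc.prems by auto
  have v: "v \<in> signed_perms n"
    unfolding v_def by (rule word_perm_signed_perms[OF i(2)])
  have w: "w = v \<circ> cox_gen i"
    unfolding v_def using snoc.prems(3) by (simp only: word_perm_snoc)
  obtain c where c: "dem_word n v c"
    using exists_dem_word[OF v] by auto
  have le: "length c \<le> length b"
    using snoc.IH[OF c i(2)] by (simp add: v_def)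
  show ?case
  proof (cases "descent i v")
    case True
    then have "dem_word n v (a @ [i])"
      using dem_word_descent[OF snoc.prems(1)[unfolded w] i(1) _ v] by blast
    from dem_word_length_eq[OF c this] le show ?thesis by simp
  next
    case False
    then have "dem_word n w (c @ [i])"
      unfolding w by (intro dem_word_snoc c i)
    from dem_word_length_eq[OF snoc.prems(1) this] le show ?thesis by simp
  qed
qed

text \<open>Prefixes of reduced words are reduced. Were the last letter a descent of the prefix
  product, the whole product would have a word shorter than the prefix.\<close>

lemma reduced_word_imp_dem_word: "reduced_word n w a \<Longrightarrow> dem_word n w a"
proof (induction a arbitrary: w rule: rev_induct)
  case Nil
  then show ?case by (auto simp: reduced_word_def dem_word_def)
next
  case (snoc i a)
  define v where "v = word_perm a"
  have i: "i < n" "set a \<subseteq> {..<n}" and w: "w = v \<circ> cox_gen i"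
    and min: "\<And>b. set b \<subseteq> {..<n} \<Longrightarrow> word_perm b = w \<Longrightarrow> Suc (length a) \<le> length b"
    using snoc.prems by (auto simp: reduced_word_def v_def)
  have v: "v \<in> signed_perms n"
    using i by (auto simp: v_def word_perm_signed_perms)
  have "length a \<le> length b" if "set b \<subseteq> {..<n}" "word_perm b = v" for b
    using min[of "b @ [i]"] that w i by simp
  then have a: "dem_word n v a"
    using i snoc.IH[of v] by (auto simp: reduced_word_def v_def)
  show ?case
  proof (cases "descent i v")
    case True
    obtain d where d: "dem_word n w d"
      using exists_dem_word[OF comp_signed_perms[OF v cox_gen_signed_perms[OF i(1)]]] unfolding w by blast
    have "dem_word n v (d @ [i])"
      using dem_word_descent[OF d[unfolded w] i(1) True v] .
    from dem_word_length_eq[OF a this] have "length a = Suc (length d)"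
      by simp
    moreover have "Suc (length a) \<le> length d"
      using min[of d] d dem_word_perm[OF d] by (simp add: dem_word_def)
    ultimately show ?thesis by simp
  next
    case False
    then show ?thesis
      unfolding w by (intro dem_word_snoc a i)
  qed
qed

lemma reduced_word_iff_dem_word: "reduced_word n w a \<longleftrightarrow> dem_word n w a"
proof
  assume a: "dem_word n w a"
  then have "set a \<subseteq> {..<n}" by (simp add: dem_word_def)
  with a show "reduced_word n w a"
    unfolding reduced_word_def using dem_word_length_le dem_word_perm by blast
qed (rule reduced_word_imp_dem_word)

text \<open>The spanning half of the basis property: every word reduces to a power of \<beta> times
  any prescribed reduced word of its Demazure product.\<close>

lemma demazure_hecke_eq:
  assumes "set a \<subseteq> {..<n}" "demazure (0, id) a = (k, w)" "dem_word n w b"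
  shows "hecke_eq n (0, a) (k, b)"
  using assms
proof (induction a arbitrary: k w b rule: rev_induct)
  case Nil
  then have "k = 0" "w = id" by (simp_all only: foldl_Nil prod.inject)
  moreover from this have "b = []" using Nil dem_word_id by metis
  ultimately show ?case by (simp add: hecke_eq.hecke_refl)
next
  case (snoc i a)
  have i: "i < n" "set a \<subseteq> {..<n}"
    using snoc.prems by auto
  obtain k' v where kv: "demazure (0, id) a = (k', v)"
    by fastforce
  have v: "v \<in> signed_perms n"
    using demazure_signed_perms[OF id_signed_perms i(2), of 0] kv by simp
  have kw: "(k, w) = dstep (k', v) i"
    using snoc.prems(2) by (simp only: foldl_append kv foldl_Cons foldl_Nil)
  have app: "hecke_eq n (0, a @ [i]) (k', c @ [i])" if "dem_word n v c" for c
    using hecke_eq_append[OF snoc.IH[OF i(2) kv that], of "[i]"] i by simp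
  show ?case
  proof (cases "descent i v")
    case True
    obtain c where c: "dem_word n (v \<circ> cox_gen i) c"
      using exists_dem_word[OF comp_signed_perms[OF v cox_gen_signed_perms[OF i(1)]]] by blast
    have w: "w = v" "k = k' + 1"
      using kw True by (auto simp: dstep_def)
    have ci: "dem_word n v (c @ [i])"
      using dem_word_descent[OF c] i True v by simp
    \<comment> \<open>By Matsumoto's theorem the reduced word of v may be chosen to end in the
      descent i, so the new letter doubles the last one.\<close>
    have ii: "hecke_eq n (k', c @ [i, i] @ []) (k' + 1, c @ [i] @ [])"
      using c i by (intro hecke_eq.hecke_step hecke_move.quadratic) (auto simp: dem_word_def)
    have cb: "hecke_eq n (k' + 1, c @ [i]) (k' + 1, b)"
      using hecke_eq_shift[OF dem_word_hecke_eq[OF ci], of b "k' + 1"] snoc.prems(3) w by simp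
    have "hecke_eq n (k', (c @ [i]) @ [i]) (k' + 1, b)"
      using hecke_eq.hecke_trans[OF ii[simplified] cb[simplified]] by simp
    from hecke_eq.hecke_trans[OF app[OF ci] this] show ?thesis
      unfolding w .
  next
    case False
    obtain c where c: "dem_word n v c"
      using exists_dem_word[OF v] by auto
    have w: "w = v \<circ> cox_gen i" "k = k'"
      using kw False by (simp_all add: dstep_def)
    have "hecke_eq n (k', c @ [i]) (k', b)"
      using hecke_eq_shift[OF dem_word_hecke_eq[OF dem_word_snoc[OF c i(1) False] snoc.prems(3)[unfolded w(1)]], of k']
      by simp
    from hecke_eq.hecke_trans[OF app[OF c] this] show ?thesis
      unfolding w .
  qed
qed

section \<open>Coordinates in the quotient algebra\<close>

abbreviation xbeta :: xpoly where
  "xbeta \<equiv> Poly_Mapping.single 0 beta"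

text \<open>Every functional needed on the free algebra is the linear extension of a function on
  words; it descends to the quotient once the function respects single moves.\<close>

definition lin :: "(nat list \<Rightarrow> xpoly) \<Rightarrow> ualg \<Rightarrow> xpoly" where
  "lin E f = (\<Sum>a\<in>Poly_Mapping.keys f. Poly_Mapping.lookup f a * E (letters a))"

lemma lin_superset:
  assumes "finite S" "Poly_Mapping.keys f \<subseteq> S"
  shows "lin E f = (\<Sum>a\<in>S. Poly_Mapping.lookup f a * E (letters a))"
  unfolding lin_def using assms by (intro sum.mono_neutral_left) (auto simp: in_keys_iff)

lemma lin_add: "lin E (f + g) = lin E f + lin E g"
proof -
  let ?S = "Poly_Mapping.keys f \<union> Poly_Mapping.keys g"
  have "lin E (f + g) = (\<Sum>a\<in>?S. Poly_Mapping.lookup (f + g) a * E (letters a))"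
    by (rule lin_superset) (auto dest: subsetD[OF keys_add])
  also have "\<dots> = lin E f + lin E g"
    by (simp add: lin_superset[of ?S f] lin_superset[of ?S g] lookup_add distrib_right sum.distrib)
  finally show ?thesis .
qed

lemma lin_zero [simp]: "lin E 0 = 0"
  by (simp add: lin_def)

lemma lin_diff: "lin E (f - g) = lin E f - lin E g"
  using lin_add[of E "f - g" g] by simp

lemma lin_sum: "lin E (\<Sum>x\<in>A. f x) = (\<Sum>x\<in>A. lin E (f x))"
  by (induction A rule: infinite_finite_induct) (simp_all add: lin_add)

lemma lin_single: "lin E (Poly_Mapping.single a c) = c * E (letters a)"
  by (cases "c = 0") (simp_all add: lin_def)

lemma poly_mapping_sum_single:
  fixes f :: "'a \<Rightarrow>\<^sub>0 'b::comm_monoid_add"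
  shows "f = (\<Sum>a\<in>Poly_Mapping.keys f. Poly_Mapping.single a (Poly_Mapping.lookup f a))"
proof (rule poly_mapping_eqI)
  fix k
  show "Poly_Mapping.lookup f k =
      Poly_Mapping.lookup (\<Sum>a\<in>Poly_Mapping.keys f. Poly_Mapping.single a (Poly_Mapping.lookup f a)) k"
    by (simp add: lookup_sum lookup_single when_def in_keys_iff)
qed

lemma single_sum: "Poly_Mapping.single x (\<Sum>a\<in>A. g a) = (\<Sum>a\<in>A. Poly_Mapping.single x (g a))"
  by (induction A rule: infinite_finite_induct) (simp_all add: single_add)

lemma lin_mult_single:
  "lin E (f * Poly_Mapping.single b c) = c * lin (\<lambda>a. E (a @ letters b)) f"
proof -
  let ?g = "\<lambda>a. Poly_Mapping.single a (Poly_Mapping.lookup f a)"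
  have "lin E (f * Poly_Mapping.single b c)
      = lin E ((\<Sum>a\<in>Poly_Mapping.keys f. ?g a) * Poly_Mapping.single b c)"
    using poly_mapping_sum_single[of f] by simp
  also have "\<dots> = (\<Sum>a\<in>Poly_Mapping.keys f. Poly_Mapping.lookup f a * c * E (letters a @ letters b))"
    by (simp add: sum_distrib_right lin_sum mult_single lin_single plus_uword_def)
  also have "\<dots> = c * lin (\<lambda>a. E (a @ letters b)) f"
    by (simp add: lin_def sum_distrib_left ac_simps)
  finally show ?thesis .
qed

lemma lin_single_mult:
  "lin E (Poly_Mapping.single b c * f) = c * lin (\<lambda>a. E (letters b @ a)) f"
proof -
  let ?g = "\<lambda>a. Poly_Mapping.single a (Poly_Mapping.lookup f a)"
  have "lin E (Poly_Mapping.single b c * f)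
      = lin E (Poly_Mapping.single b c * (\<Sum>a\<in>Poly_Mapping.keys f. ?g a))"
    using poly_mapping_sum_single[of f] by simp
  also have "\<dots> = (\<Sum>a\<in>Poly_Mapping.keys f. c * Poly_Mapping.lookup f a * E (letters b @ letters a))"
    by (simp add: sum_distrib_left lin_sum mult_single lin_single plus_uword_def)
  also have "\<dots> = c * lin (\<lambda>a. E (letters b @ a)) f"
    by (simp add: lin_def sum_distrib_left ac_simps)
  finally show ?thesis .
qed

lemma scal_mult_single: "scal c * Poly_Mapping.single a d = Poly_Mapping.single a (c * d)"
  by (simp add: scal_def mult_single)

lemma lin_mult_factor:
  "lin E (f * (1 + scal x * ugen i)) = lin E f + x * lin (\<lambda>a. E (a @ [i])) f"
  by (simp add: distrib_left lin_add ugen_def scal_mult_single lin_mult_single)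

abbreviation uw :: "nat list \<Rightarrow> ualg" where
  "uw a \<equiv> Poly_Mapping.single (UWord a) 1"

lemma prod_list_ugen: "prod_list (map ugen a) = uw a"
  by (induction a) (simp_all add: ugen_def mult_single plus_uword_def flip: zero_uword_def)

definition relator :: "nat list \<Rightarrow> nat list \<Rightarrow> nat \<Rightarrow> ualg" where
  "relator r s d = uw r - Poly_Mapping.single (UWord s) (xbeta ^ d)"

lemma relators_eq: "relators n = {relator r s d | r s d. hecke_move n r s d}"
proof -
  have "relators n = {relator [i, i] [i] 1 | i. i < n}
      \<union> (if 1 < n then {relator [1, 0, 1, 0] [0, 1, 0, 1] 0} else {})
      \<union> {relator [i, i + 1, i] [i + 1, i, i + 1] 0 | i. 0 < i \<and> i + 1 < n}
      \<union> {relator [i, j] [j, i] 0 | i j. i < n \<and> j < n \<and> \<bar>int i - int j\<bar> > 1}"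
    by (simp add: relators_def relator_def ugen_def scal_mult_single mult_single plus_uword_def)
  also have "\<dots> = {relator r s d | r s d. hecke_move n r s d}"
  proof (rule set_eqI, rule iffI)
    fix x
    assume "x \<in> {relator r s d | r s d. hecke_move n r s d}"
    then obtain r s d where x: "x = relator r s d" and m: "hecke_move n r s d" by blast
    from m show "x \<in> {relator [i, i] [i] 1 | i. i < n}
      \<union> (if 1 < n then {relator [1, 0, 1, 0] [0, 1, 0, 1] 0} else {})
      \<union> {relator [i, i + 1, i] [i + 1, i, i + 1] 0 | i. 0 < i \<and> i + 1 < n}
      \<union> {relator [i, j] [j, i] 0 | i j. i < n \<and> j < n \<and> \<bar>int i - int j\<bar> > 1}"
      unfolding x by cases auto
  qed (auto split: if_splits intro: hecke_move.intros[simplified] hecke_move.intros)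
  finally show ?thesis .
qed

text \<open>By linearity both cofactors of a relator may be taken to be single words, and there the
  hypothesis makes the two terms of the relator cancel.\<close>

lemma lin_rel_ideal:
  assumes E: "\<And>r s d a b. hecke_move n r s d \<Longrightarrow> set a \<subseteq> {..<n} \<Longrightarrow> set b \<subseteq> {..<n} \<Longrightarrow>
      E (a @ r @ b) = xbeta ^ d * E (a @ s @ b)"
    and f: "f \<in> rel_ideal n"
  shows "lin E f = 0"
  using f
proof induction
  case (gen r p q)
  obtain r' s d where r: "r = relator r' s d" and m: "hecke_move n r' s d"
    using gen(1) by (auto simp: relators_eq)
  have single: "lin E (Poly_Mapping.single a c * r * Poly_Mapping.single b e) = 0"
    if "a \<in> Poly_Mapping.keys p" "b \<in> Poly_Mapping.keys q" for a b c e
  proof -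
    have "set (letters a) \<subseteq> {..<n}" "set (letters b) \<subseteq> {..<n}"
      using gen that by (auto simp: free_ualg_def)
    from E[OF m this] show ?thesis
      by (simp add: lin_mult_single lin_single_mult r relator_def lin_diff lin_single)
  qed
  have "p * r * q = (\<Sum>a\<in>Poly_Mapping.keys p. Poly_Mapping.single a (Poly_Mapping.lookup p a)) * r *
      (\<Sum>b\<in>Poly_Mapping.keys q. Poly_Mapping.single b (Poly_Mapping.lookup q b))"
    using poly_mapping_sum_single[of p] poly_mapping_sum_single[of q] by simp
  also have "\<dots> = (\<Sum>a\<in>Poly_Mapping.keys p. \<Sum>b\<in>Poly_Mapping.keys q.
      Poly_Mapping.single a (Poly_Mapping.lookup p a) * r * Poly_Mapping.single b (Poly_Mapping.lookup q b))"
    by (simp add: sum_distrib_left sum_distrib_right) (rule sum.swap)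
  finally show ?case
    by (simp add: lin_sum single)
qed (simp_all add: lin_add)

lemma free_ualg_mult: "p \<in> free_ualg n \<Longrightarrow> q \<in> free_ualg n \<Longrightarrow> p * q \<in> free_ualg n"
  by (fastforce simp: free_ualg_def plus_uword_def dest!: subsetD[OF keys_mult])

lemma free_ualg_add: "p \<in> free_ualg n \<Longrightarrow> q \<in> free_ualg n \<Longrightarrow> p + q \<in> free_ualg n"
  by (auto simp: free_ualg_def dest!: subsetD[OF keys_add])

lemma free_ualg_uminus: "p \<in> free_ualg n \<Longrightarrow> - p \<in> free_ualg n"
  by (auto simp: free_ualg_def in_keys_iff)

lemma free_ualg_single: "set a \<subseteq> {..<n} \<Longrightarrow> Poly_Mapping.single (UWord a) c \<in> free_ualg n"
  by (auto simp: free_ualg_def)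

lemma free_ualg_one: "1 \<in> free_ualg n"
  by (simp add: free_ualg_def zero_uword_def)

lemma free_ualg_scal: "scal c \<in> free_ualg n"
  using free_ualg_single[of "[]" n c] by (simp add: scal_def zero_uword_def)

lemma free_ualg_prod_list: "set fs \<subseteq> free_ualg n \<Longrightarrow> prod_list fs \<in> free_ualg n"
  by (induction fs) (simp_all add: free_ualg_one free_ualg_mult)

lemma C_prod_free_ualg: "C_prod n m \<in> free_ualg n"
proof -
  have "C_factor n i \<in> free_ualg n" for i
    unfolding C_factor_def
    by (intro free_ualg_prod_list)
      (auto simp: ugen_def intro!: free_ualg_add free_ualg_mult free_ualg_one free_ualg_scal free_ualg_single)
  then show ?thesis
    unfolding C_prod_def by (intro free_ualg_prod_list) auto
qed

lemma rel_ideal_scal: "f \<in> rel_ideal n \<Longrightarrow> scal c * f \<in> rel_ideal n"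
proof (induction rule: rel_ideal.induct)
  case (gen r p q)
  have "scal c * (p * r * q) = (scal c * p) * r * q"
    by (simp add: mult.assoc)
  with gen show ?case
    by (simp only: rel_ideal.gen free_ualg_mult free_ualg_scal)
qed (simp_all add: distrib_left rel_ideal.intros)

lemma rel_ideal_uminus: "f \<in> rel_ideal n \<Longrightarrow> - f \<in> rel_ideal n"
proof (induction rule: rel_ideal.induct)
  case (gen r p q)
  have "- (p * r * q) = (- p) * r * q"
    by simp
  with gen show ?case
    by (simp only: rel_ideal.gen free_ualg_uminus)
next
  case (add f g)
  then show ?case using rel_ideal.add[of "- f" n "- g"] by simp
qed (simp add: rel_ideal.intros)

lemma rel_ideal_sum: "(\<And>x. x \<in> A \<Longrightarrow> f x \<in> rel_ideal n) \<Longrightarrow> (\<Sum>x\<in>A. f x) \<in> rel_ideal n"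
  by (induction A rule: infinite_finite_induct) (simp_all add: rel_ideal.intros)

lemma hecke_eq_rel_ideal:
  "hecke_eq n p q \<Longrightarrow> Poly_Mapping.single (UWord (snd p)) (xbeta ^ fst p)
    - Poly_Mapping.single (UWord (snd q)) (xbeta ^ fst q) \<in> rel_ideal n"
proof (induction rule: hecke_eq.induct)
  case (hecke_refl p)
  then show ?case by (simp add: rel_ideal.zero)
next
  case (hecke_sym p q)
  from rel_ideal_uminus[OF hecke_sym.IH] show ?case by simp
next
  case (hecke_trans p q r)
  from rel_ideal.add[OF hecke_trans.IH] show ?case by simp
next
  case (hecke_step r s d a b k)
  have "Poly_Mapping.single (UWord a) (xbeta ^ k) * relator r s d * uw b \<in> rel_ideal n"
    using hecke_step by (intro rel_ideal.gen free_ualg_single) (auto simp: relators_eq)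
  then show ?case
    by (simp add: relator_def left_diff_distrib right_diff_distrib mult_single plus_uword_def power_add)
qed

text \<open>The coordinate functional dual to u_w, given on words.\<close>

definition dem_coeff :: "(int \<Rightarrow> int) \<Rightarrow> nat list \<Rightarrow> xpoly" where
  "dem_coeff w a =
    (if snd (demazure (0, id) a) = w then xbeta ^ fst (demazure (0, id) a) else 0)"

lemma dem_coeff_hecke_move:
  assumes "hecke_move n r s d" "set a \<subseteq> {..<n}" "set b \<subseteq> {..<n}"
  shows "dem_coeff w (a @ r @ b) = xbeta ^ d * dem_coeff w (a @ s @ b)"
proof -
  have "hecke_eq n (0, a @ r @ b) (0 + d, a @ s @ b)"
    using assms by (rule hecke_eq.hecke_step)
  from hecke_eq_demazure[OF this] demazure_shift[of 0 d id "a @ s @ b"]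
  have "demazure (0, id) (a @ r @ b) =
      (fst (demazure (0, id) (a @ s @ b)) + d, snd (demazure (0, id) (a @ s @ b)))"
    by (simp only: fst_conv snd_conv)
  moreover obtain k v where kv: "demazure (0, id) (a @ s @ b) = (k, v)"
    by fastforce
  ultimately have "demazure (0, id) (a @ r @ b) = (k + d, v)"
    by (simp only: fst_conv snd_conv)
  with kv show ?thesis
    by (simp only: dem_coeff_def fst_conv snd_conv) (simp add: power_add mult.commute)
qed

text \<open>\<open>THE\<close> needs existence and uniqueness. Each word of f is congruent to
  \<beta>^k times the chosen reduced word of its Demazure product, so these values are coordinates;
  the functionals vanish on the ideal and are dual to the u_w, so there are no others.\<close>

lemma u_coeffs_eq_lin:
  assumes f: "f \<in> free_ualg n" and w: "w \<in> signed_perms n"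
  shows "u_coeffs n f w = lin (dem_coeff w) f"
proof -
  define b where "b w = (SOME a. reduced_word n w a)" for w
  have b: "dem_word n v (b v)" if "v \<in> signed_perms n" for v
  proof -
    have "\<exists>a. reduced_word n v a"
      using exists_dem_word[OF that] by (simp add: reduced_word_iff_dem_word)
    then have "reduced_word n v (b v)"
      unfolding b_def by (rule someI_ex)
    then show ?thesis
      by (simp add: reduced_word_iff_dem_word)
  qed
  have u: "u_perm n v = uw (b v)" for v
    by (simp add: u_perm_def prod_list_ugen b_def)
  let ?c = "\<lambda>v. if v \<in> signed_perms n then lin (dem_coeff v) f else 0"
  let ?K = "Poly_Mapping.keys f"
  have "u_coeffs n f = ?c"
    unfolding u_coeffs_def
  proof (rule the_equality)
    have wd: "\<exists>k v. demazure (0, id) (letters a) = (k, v) \<and> v \<in> signed_perms n \<and>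
        uw (letters a) - Poly_Mapping.single (UWord (b v)) (xbeta ^ k) \<in> rel_ideal n"
      if "a \<in> ?K" for a
    proof -
      obtain k v where kv: "demazure (0, id) (letters a) = (k, v)"
        by fastforce
      have a: "set (letters a) \<subseteq> {..<n}"
        using f that by (auto simp: free_ualg_def)
      have v: "v \<in> signed_perms n"
        using demazure_signed_perms[OF id_signed_perms a, of 0] kv by simp
      from hecke_eq_rel_ideal[OF demazure_hecke_eq[OF a kv b[OF v]]] kv v show ?thesis
        by (intro exI[of _ k] exI[of _ v]) simp
    qed
    have "f - (\<Sum>v\<in>signed_perms n. scal (?c v) * u_perm n v) =
      (\<Sum>a\<in>?K. Poly_Mapping.single a (Poly_Mapping.lookup f a)) -
      (\<Sum>v\<in>signed_perms n. \<Sum>a\<in>?K.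
        Poly_Mapping.single (UWord (b v)) (Poly_Mapping.lookup f a * dem_coeff v (letters a)))"
      using poly_mapping_sum_single[of f] by (simp add: u scal_mult_single lin_def single_sum)
    also have "\<dots> = (\<Sum>a\<in>?K. Poly_Mapping.single a (Poly_Mapping.lookup f a) -
      (\<Sum>v\<in>signed_perms n.
        Poly_Mapping.single (UWord (b v)) (Poly_Mapping.lookup f a * dem_coeff v (letters a))))"
      by (subst sum.swap) (simp add: sum_subtractf)
    also have "\<dots> \<in> rel_ideal n"
    proof (rule rel_ideal_sum)
      fix a assume "a \<in> ?K"
      then obtain k v where kv: "demazure (0, id) (letters a) = (k, v)" "v \<in> signed_perms n"
        and id: "uw (letters a) - Poly_Mapping.single (UWord (b v)) (xbeta ^ k) \<in> rel_ideal n"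
        using wd by blast
      have dc: "dem_coeff v' (letters a) = (if v = v' then xbeta ^ k else 0)" for v'
        by (simp only: dem_coeff_def kv fst_conv snd_conv)
      have "(\<Sum>v'\<in>signed_perms n.
          Poly_Mapping.single (UWord (b v')) (Poly_Mapping.lookup f a * dem_coeff v' (letters a)))
        = (\<Sum>v'\<in>signed_perms n. if v = v' then
            Poly_Mapping.single (UWord (b v')) (Poly_Mapping.lookup f a * xbeta ^ k) else 0)"
        by (intro sum.cong) (auto simp: dc)
      also have "\<dots> = Poly_Mapping.single (UWord (b v)) (Poly_Mapping.lookup f a * xbeta ^ k)"
        using kv(2) by (simp add: finite_signed_perms)
      finally show "Poly_Mapping.single a (Poly_Mapping.lookup f a) -
          (\<Sum>v'\<in>signed_perms n. Poly_Mapping.single (UWord (b v'))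
            (Poly_Mapping.lookup f a * dem_coeff v' (letters a))) \<in> rel_ideal n"
        using rel_ideal_scal[OF id, of "Poly_Mapping.lookup f a"]
        by (simp add: right_diff_distrib scal_mult_single)
    qed
    finally show "(\<forall>w. w \<notin> signed_perms n \<longrightarrow> ?c w = 0) \<and>
        f - (\<Sum>v\<in>signed_perms n. scal (?c v) * u_perm n v) \<in> rel_ideal n"
      by simp
  next
    fix c
    assume c: "(\<forall>w. w \<notin> signed_perms n \<longrightarrow> c w = 0) \<and>
        f - (\<Sum>v\<in>signed_perms n. scal (c v) * u_perm n v) \<in> rel_ideal n"
    have "c v = lin (dem_coeff v) f" if v: "v \<in> signed_perms n" for v
    proof -
      have dc: "dem_coeff v (b v') = (if v = v' then 1 else 0)" if "v' \<in> signed_perms n" for v'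
      proof -
        have "demazure (0, id) (b v') = (0, v')"
          using b[OF that] by (simp add: dem_word_def)
        then have "dem_coeff v (b v') = (if v' = v then 1 else 0)"
          by (simp only: dem_coeff_def fst_conv snd_conv power_0)
        then show ?thesis by auto
      qed
      have "lin (dem_coeff v) (f - (\<Sum>v\<in>signed_perms n. scal (c v) * u_perm n v)) = 0"
        using c by (intro lin_rel_ideal[of n] dem_coeff_hecke_move) auto
      then have "lin (dem_coeff v) f = (\<Sum>v'\<in>signed_perms n. c v' * dem_coeff v (b v'))"
        by (simp add: lin_diff lin_sum u scal_mult_single lin_single)
      also have "\<dots> = (\<Sum>v'\<in>signed_perms n. if v = v' then c v' else 0)"
        by (intro sum.cong) (auto simp: dc)
      also have "\<dots> = c v"
        using v by (simp add: finite_signed_perms)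
      finally show ?thesis by simp
    qed
    then show "c = ?c" using c by auto
  qed
  then show ?thesis using w by simp
qed

section \<open>The action on shifted shapes\<close>

text \<open>A shape is encoded by the number \<open>h i\<close> of its boxes on the diagonal of index \<open>i\<close>; the strict
  partitions are the eventually zero functions that decrease by at most one at each step. The
  function \<open>g\<close> is the inner shape, whose boxes are never removable.\<close>

definition staircase :: "(nat \<Rightarrow> nat) \<Rightarrow> bool" where
  "staircase h \<longleftrightarrow> (\<forall>i. h (Suc i) \<le> h i \<and> h i \<le> Suc (h (Suc i)))"

text \<open>The last box on diagonal i is (h i, h i + i). Its right neighbour would be box number h
  i of diagonal i + 1, and the box below it number h i + 1 of diagonal i - 1; nothing can lie below
  a box of diagonal 0. For a staircase the equations say that both are absent.\<close>

definition removable :: "(nat \<Rightarrow> nat) \<Rightarrow> nat \<Rightarrow> (nat \<Rightarrow> nat) \<Rightarrow> bool" where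
  "removable g i h \<longleftrightarrow> g i < h i \<and> h i = Suc (h (Suc i)) \<and> (i = 0 \<or> h (i - 1) = h i)"

text \<open>For a staircase: the boxes above and to the left of the new box are present, which lie
  on diagonals i + 1 and i - 1.\<close>

definition addable :: "nat \<Rightarrow> (nat \<Rightarrow> nat) \<Rightarrow> bool" where
  "addable i h \<longleftrightarrow> h i = h (Suc i) \<and> (i = 0 \<or> h (i - 1) = Suc (h i))"

text \<open>\<open>None\<close> is the zero vector and \<open>Some (k, h)\<close> is \<beta>^k times
  the basis vector h.\<close>

fun sstep :: "(nat \<Rightarrow> nat) \<Rightarrow> (nat \<times> (nat \<Rightarrow> nat)) option \<Rightarrow> nat \<Rightarrow> (nat \<times> (nat \<Rightarrow> nat)) option" where
  "sstep g None i = None"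
| "sstep g (Some (k, h)) i =
    (if removable g i h then Some (Suc k, h)
     else if addable i h then Some (k, h(i := Suc (h i))) else None)"

abbreviation srun :: "(nat \<Rightarrow> nat) \<Rightarrow> nat \<Rightarrow> nat list \<Rightarrow> (nat \<times> (nat \<Rightarrow> nat)) option" where
  "srun g k a \<equiv> foldl (sstep g) (Some (k, g)) a"

lemma foldl_sstep_None [simp]: "foldl (sstep g) None a = None"
  by (induction a) simp_all

lemma not_removable_addable: "addable i h \<Longrightarrow> \<not> removable g i h"
  by (auto simp: addable_def removable_def)

lemma removable_add:
  assumes "addable i h" "g \<le> h"
  shows "removable g i (h(i := Suc (h i)))"
proof -
  have "g i \<le> h i" using assms(2) by (simp add: le_fun_def)
  with assms(1) show ?thesis by (auto simp: addable_def removable_def)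
qed

lemma addable_remove:
  "removable g i h \<Longrightarrow> addable i (h(i := h i - 1))"
  by (auto simp: addable_def removable_def)

lemma staircase_add: "staircase h \<Longrightarrow> addable i h \<Longrightarrow> staircase (h(i := Suc (h i)))"
  unfolding staircase_def addable_def by (auto simp: all_conj_distrib)

lemma staircase_remove: "staircase h \<Longrightarrow> removable g i h \<Longrightarrow> staircase (h(i := h i - 1))"
  unfolding staircase_def removable_def by (auto simp: all_conj_distrib)

lemma srun_invariant:
  assumes "staircase g" "srun g k a = Some (l, h)"
  shows "staircase h \<and> g \<le> h"
  using assms(2)
proof (induction a arbitrary: l h rule: rev_induct)
  case Nil
  then show ?case using assms(1) by simp
next
  case (snoc i a)
  then obtain l' h' where "srun g k a = Some (l', h')"
    by (cases "srun g k a") auto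
  with snoc.IH have h': "srun g k a = Some (l', h')" "staircase h'" "g \<le> h'"
    by simp_all
  show ?case
  proof (cases "removable g i h'")
    case True
    with h' snoc.prems show ?thesis by simp
  next
    case False
    then have a: "addable i h'" and h: "h = h'(i := Suc (h' i))"
      using h' snoc.prems by (auto split: if_splits)
    have "g \<le> h"
      using h'(3) unfolding h by (simp add: le_fun_def le_SucI)
    moreover have "staircase h"
      unfolding h by (rule staircase_add[OF h'(2) a])
    ultimately show ?thesis by simp
  qed
qed

lemma foldl_sstep_shift:
  "foldl (sstep g) (Some (k + d, h)) a =
    map_option (\<lambda>(l, h'). (l + d, h')) (foldl (sstep g) (Some (k, h)) a)"
proof (induction a rule: rev_induct)
  case (snoc i a)
  then show ?case
    by (cases "foldl (sstep g) (Some (k, h)) a") auto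
qed simp

lemma removable_update:
  "\<bar>int i - int j\<bar> > 1 \<Longrightarrow> removable g i (h(j := x)) \<longleftrightarrow> removable g i h"
  by (auto simp: removable_def)

lemma addable_update:
  "\<bar>int i - int j\<bar> > 1 \<Longrightarrow> addable i (h(j := x)) \<longleftrightarrow> addable i h"
  by (auto simp: addable_def)

text \<open>Whether the letter found a corner or created one, a corner is left behind. This is all
  that the vanishing of the braid words needs about their first letter.\<close>

lemma sstep_removable:
  assumes "sstep g (Some (k, h)) i = Some (k', h')" "g \<le> h"
  shows "removable g i h'"
  using assms by (auto split: if_splits simp: removable_add)

lemma srun_hecke_move:
  assumes m: "hecke_move n r s d" and h: "staircase h" "g \<le> h"
  shows "foldl (sstep g) (Some (k, h)) r = foldl (sstep g) (Some (k + d, h)) s"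
proof -
  have None: "foldl (sstep g) (Some (k, h)) (i # a) = None"
    if "\<And>k h. removable g i h \<Longrightarrow> foldl (sstep g) (Some (k, h)) a = None" for i a
  proof (cases "sstep g (Some (k, h)) i")
    case None
    then show ?thesis by (simp only: foldl_Cons foldl_sstep_None)
  next
    case (Some p)
    obtain k' h' where p: "p = (k', h')" by fastforce
    have "removable g i h'"
      using Some h(2) unfolding p by (rule sstep_removable)
    then show ?thesis
      unfolding foldl_Cons Some p by (rule that)
  qed
  show ?thesis
    using m
  proof cases
    case (quadratic i)
    have "removable g i (h(i := Suc (h i)))" if "addable i h"
      using that h(2) by (rule removable_add)
    then show ?thesis
      using quadratic by (cases "removable g i h"; cases "addable i h") simp_all
  next
    case braid4
    \<comment> \<open>Already 1, 0, 1 vanishes, since diagonal 2 has not grown between the two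
      letters 1. In 0, 1, 0, 1 the letter 0 can be repeated, as diagonal 0 has a single neighbour,
      and it is the second 1 that fails.\<close>
    have "foldl (sstep g) (Some (k, h)) [1, 0, 1, 0] = None"
      by (rule None) (auto simp: removable_def addable_def)
    moreover have "foldl (sstep g) (Some (k, h)) [0, 1, 0, 1] = None"
      by (rule None) (auto simp: removable_def addable_def)
    ultimately show ?thesis using braid4 by simp
  next
    case (braid3 i)
    \<comment> \<open>Here diagonal i - 1, which exists because 0 < i, has not grown; in the other
      word diagonal i + 2 has not.\<close>
    have "foldl (sstep g) (Some (k, h)) [i, Suc i, i] = None"
      using braid3(4) by (intro None) (auto simp: removable_def addable_def)
    moreover have "foldl (sstep g) (Some (k, h)) [Suc i, i, Suc i] = None"
      using braid3(4) by (intro None) (auto simp: removable_def addable_def)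
    ultimately show ?thesis using braid3 by simp
  next
    case (commute i j)
    then have ij: "\<bar>int i - int j\<bar> > 1" "\<bar>int j - int i\<bar> > 1" "i \<noteq> j" by auto
    have "h(i := Suc (h i), j := Suc (h j)) = h(j := Suc (h j), i := Suc (h i))"
      using ij(3) by (rule fun_upd_twist)
    then show ?thesis
      using commute ij
      by (cases "removable g i h"; cases "removable g j h"; cases "addable i h"; cases "addable j h")
        (simp_all add: removable_update addable_update)
  qed
qed

lemma srun_hecke_eq:
  assumes "hecke_eq n p q" "staircase g"
  shows "srun g (fst p) (snd p) = srun g (fst q) (snd q)"
  using assms(1)
proof induction
  case (hecke_step r s d a b k)
  show ?case
  proof (cases "srun g k a")
    case None
    then show ?thesis by (simp add: foldl_sstep_shift)
  next
    case (Some p)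
    obtain l h where p: "p = (l, h)" by fastforce
    have "foldl (sstep g) (Some (l, h)) r = foldl (sstep g) (Some (l + d, h)) s"
      using srun_hecke_move[OF hecke_step(1)] srun_invariant[OF assms(2) Some[unfolded p]] by blast
    then show ?thesis
      using Some p foldl_sstep_shift[of g k d g a] by simp
  qed
qed simp_all

section \<open>Words that only add boxes, and their products\<close>

lemma srun_snoc_add:
  "srun g k a = Some (l, h) \<Longrightarrow> addable i h \<Longrightarrow> srun g k (a @ [i]) = Some (l, h(i := Suc (h i)))"
  by (simp add: not_removable_addable)

lemma srun_snocD:
  assumes "staircase g" "srun g 0 (a @ [i]) = Some (0, h)"
  shows "removable g i h" "srun g 0 a = Some (0, h(i := h i - 1))"
proof -
  obtain l h' where h': "srun g 0 a = Some (l, h')"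
    using assms(2) by (cases "srun g 0 a") auto
  then have "l = 0" "addable i h'" "h = h'(i := Suc (h' i))"
    using assms(2) by (auto split: if_splits)
  then show "removable g i h" "srun g 0 a = Some (0, h(i := h i - 1))"
    using h' srun_invariant[OF assms(1) h'] by (auto simp: removable_add)
qed

text \<open>The box can be moved to the end of the word because every letter after it commutes with it.\<close>

lemma srun_removable_last:
  assumes g: "staircase g"
  shows "srun g 0 b = Some (0, h) \<Longrightarrow> removable g i h \<Longrightarrow>
    \<exists>c. srun g 0 c = Some (0, h(i := h i - 1)) \<and> word_perm (c @ [i]) = word_perm b
      \<and> set c \<subseteq> set b \<and> Suc (length c) = length b"
proof (induction b arbitrary: h rule: rev_induct)
  case Nil
  then show ?case by (auto simp: removable_def)
next
  case (snoc j b)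
  note j = srun_snocD[OF g snoc.prems(1)]
  show ?case
  proof (cases "i = j")
    case True
    then show ?thesis using j by (intro exI[of _ b]) auto
  next
    case False
    \<comment> \<open>The last boxes of neighbouring diagonals i and i + 1 cannot both be corners:
      one would force h i = h (i + 1) + 1, the other h i = h (i + 1).\<close>
    have ij: "\<bar>int i - int j\<bar> > 1"
    proof (rule ccontr)
      assume "\<not> ?thesis"
      with False have "i = Suc j \<or> j = Suc i" by linarith
      then show False using j(1) snoc.prems(2) by (auto simp: removable_def)
    qed
    let ?h = "h(j := h j - 1)"
    have "removable g i ?h"
      using snoc.prems(2) ij by (simp only: removable_update)
    from snoc.IH[OF j(2) this]
    obtain c where c: "srun g 0 c = Some (0, ?h(i := ?h i - 1))" "word_perm (c @ [i]) = word_perm b"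
      "set c \<subseteq> set b" "Suc (length c) = length b"
      by blast
    have "addable j (?h(i := ?h i - 1))"
      using addable_remove[OF j(1)] ij by (simp add: addable_update)
    moreover have "h(i := h i - 1) = (?h(i := ?h i - 1))(j := Suc ((?h(i := ?h i - 1)) j))"
      using False j(1) by (auto simp: fun_eq_iff removable_def)
    ultimately have "srun g 0 (c @ [j]) = Some (0, h(i := h i - 1))"
      using srun_snoc_add[OF c(1)] by (simp only:)
    moreover have "word_perm ((c @ [j]) @ [i]) = word_perm (b @ [j])"
    proof -
      have "cox_gen j \<circ> cox_gen i = cox_gen i \<circ> cox_gen j"
        using cox_gen_commute[OF ij] by (simp add: fun_eq_iff)
      then show ?thesis
        using c(2) by (simp only: word_perm_snoc comp_assoc) (simp only: word_perm_snoc flip: comp_assoc)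
    qed
    ultimately show ?thesis
      using c by (intro exI[of _ "c @ [j]"]) auto
  qed
qed

text \<open>Peel the last box off \<open>a\<close>; \<open>srun_removable_last\<close> moves the
  same box to the end of \<open>b\<close> without changing the product.\<close>

lemma srun_perm_unique:
  assumes g: "staircase g"
  shows "srun g 0 a = Some (0, h) \<Longrightarrow> srun g 0 b = Some (0, h) \<Longrightarrow> word_perm a = word_perm b"
proof (induction a arbitrary: h b rule: rev_induct)
  case Nil
  then have "h = g" by simp
  then have "b = []"
    using srun_snocD(1)[OF g] Nil.prems(2) by (cases b rule: rev_cases) (auto simp: removable_def)
  then show ?case by simp
next
  case (snoc i a)
  note i = srun_snocD[OF g snoc.prems(1)]
  obtain c where c: "srun g 0 c = Some (0, h(i := h i - 1))" "word_perm (c @ [i]) = word_perm b"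
    using srun_removable_last[OF g snoc.prems(2) i(1)] by blast
  from snoc.IH[OF i(2) c(1)] c(2) show ?case
    by (simp only: word_perm_snoc)
qed

text \<open>Action and Demazure product advance in step: a letter gives \<beta> in both or in
  neither. The reduced word b, which builds the current shape by additions alone, is carried along
  to compare descents with corners.\<close>

lemma srun_imp_demazure:
  assumes g: "staircase g" and "set a \<subseteq> {..<n}" "srun g 0 a = Some (k, h)"
  shows "\<exists>w b. demazure (0, id) a = (k, w) \<and> dem_word n w b \<and> srun g 0 b = Some (0, h)"
  using assms(2-)
proof (induction a arbitrary: k h rule: rev_induct)
  case Nil
  then show ?case
    by (intro exI[of _ id] exI[of _ "[]"]) (auto simp: dem_word_def)
next
  case (snoc i a)
  have i: "i < n" "set a \<subseteq> {..<n}" using snoc.prems by auto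
  obtain k' h' where kh: "srun g 0 a = Some (k', h')"
    using snoc.prems(2) by (cases "srun g 0 a") auto
  obtain w b where wb: "demazure (0, id) a = (k', w)" "dem_word n w b" "srun g 0 b = Some (0, h')"
    using snoc.IH[OF i(2) kh] by blast
  have w: "w \<in> signed_perms n"
    using wb(2) by (rule dem_word_signed_perms)
  have dem: "demazure (0, id) (a @ [i]) = dstep (k', w) i"
    by (simp only: foldl_append wb(1) foldl_Cons foldl_Nil)
  have ws: "w \<circ> cox_gen i \<in> signed_perms n"
    by (intro comp_signed_perms w cox_gen_signed_perms i)
  show ?case
  proof (cases "descent i w")
    case True
    obtain c where c: "dem_word n (w \<circ> cox_gen i) c"
      using exists_dem_word[OF ws] by blast
    \<comment> \<open>A descent gives a reduced word of w ending in i. It acts as b does, so its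
      last letter left a corner on diagonal i.\<close>
    have "hecke_eq n (0, b) (0, c @ [i])"
      by (rule dem_word_hecke_eq[OF wb(2) dem_word_descent[OF c i(1) True w]])
    from srun_hecke_eq[OF this g] have "srun g 0 (c @ [i]) = Some (0, h')"
      using wb(3) by simp
    from srun_snocD(1)[OF g this] have "k = Suc k'" "h = h'"
      using snoc.prems(2) kh by auto
    moreover have "dstep (k', w) i = (Suc k', w)"
      using True by (simp add: dstep_def)
    ultimately show ?thesis
      using wb dem by (intro exI[of _ w] exI[of _ b]) (simp only: simp_thms)
  next
    case False
    have bi: "dem_word n (w \<circ> cox_gen i) (b @ [i])"
      by (rule dem_word_snoc[OF wb(2) i(1) False])
    \<comment> \<open>Moving a corner to the end of b and dropping it would give a word for w s_i
      that is shorter than b, although i is an ascent of w.\<close>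
    have "\<not> removable g i h'"
    proof
      assume "removable g i h'"
      then obtain c where c: "word_perm (c @ [i]) = word_perm b" "set c \<subseteq> set b" "Suc (length c) = length b"
        using srun_removable_last[OF g wb(3)] by blast
      have "word_perm c = word_perm c \<circ> cox_gen i \<circ> cox_gen i"
        by (simp only: comp_cox_gen_cancel)
      also have "\<dots> = w \<circ> cox_gen i"
        using c(1) dem_word_perm[OF wb(2)] by (simp only: word_perm_snoc)
      finally have "length (b @ [i]) \<le> length c"
        using dem_word_length_le[OF bi, of c] c(2) wb(2) by (auto simp: dem_word_def)
      then show False using c(3) by simp
    qed
    then have *: "addable i h'" "k = k'" "h = h'(i := Suc (h' i))"
      using snoc.prems(2) kh by (auto split: if_splits)
    have "dstep (k', w) i = (k', w \<circ> cox_gen i)"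
      using False by (simp add: dstep_def)
    then show ?thesis
      using bi dem srun_snoc_add[OF wb(3) *(1)] *(2,3)
      by (intro exI[of _ "w \<circ> cox_gen i"] exI[of _ "b @ [i]"]) (simp only: simp_thms)
  qed
qed

definition shape_coeff :: "(nat \<Rightarrow> nat) \<Rightarrow> (nat \<Rightarrow> nat) \<Rightarrow> nat list \<Rightarrow> xpoly" where
  "shape_coeff g h a = (case srun g 0 a of None \<Rightarrow> 0 | Some (k, h') \<Rightarrow> if h' = h then xbeta ^ k else 0)"

text \<open>If \<open>a\<close> has the Demazure product of \<open>a0\<close>, it is congruent to
  \<beta>^k times \<open>a0\<close> and acts accordingly. If \<open>a\<close> reaches h, its reduced
  form reaches h by additions alone, and \<open>srun_perm_unique\<close> identifies the
  products.\<close>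

lemma dem_coeff_eq_shape_coeff:
  assumes g: "staircase g" and a0: "set a0 \<subseteq> {..<n}" "srun g 0 a0 = Some (0, h)" and a: "set a \<subseteq> {..<n}"
  shows "dem_coeff (word_perm a0) a = shape_coeff g h a"
proof -
  obtain w0 where w0: "demazure (0, id) a0 = (0, w0)"
    using srun_imp_demazure[OF g a0] by blast
  then have dw: "dem_word n w0 a0"
    using a0(1) by (simp add: dem_word_def)
  have w0': "word_perm a0 = w0"
    by (rule dem_word_perm[OF dw])
  obtain k w where kw: "demazure (0, id) a = (k, w)"
    by fastforce
  have dc: "dem_coeff (word_perm a0) a = (if w = w0 then xbeta ^ k else 0)"
    by (simp only: dem_coeff_def kw w0' fst_conv snd_conv)
  have 1: "shape_coeff g h a = xbeta ^ k" if "w = w0"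
  proof -
    have "hecke_eq n (0, a) (k, a0)"
      using demazure_hecke_eq[OF a kw[unfolded that] dw] .
    from srun_hecke_eq[OF this g] have "srun g 0 a = Some (k, h)"
      using foldl_sstep_shift[of g 0 k g a0] a0(2) by simp
    then show ?thesis by (simp add: shape_coeff_def)
  qed
  have 2: "w = w0" if s: "srun g 0 a = Some (l, h)" for l
  proof -
    obtain b where b: "dem_word n w b" "srun g 0 b = Some (0, h)"
      using srun_imp_demazure[OF g a s] kw by auto
    show ?thesis
      using srun_perm_unique[OF g b(2) a0(2)] dem_word_perm[OF b(1)] w0' by (simp only:)
  qed
  show ?thesis
  proof (cases "w = w0")
    case True
    then show ?thesis using 1 dc by simp
  next
    case False
    then show ?thesis
      using 2 dc by (auto simp: shape_coeff_def split: option.split)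
  qed
qed

text \<open>The transposed action: a letter i leaves a corner on diagonal i, found there or just
  created. Peeling the last letter suits tableaux, where the latest factor can only occupy a
  corner.\<close>

lemma shape_coeff_snoc:
  assumes "staircase g"
  shows "shape_coeff g h (a @ [i]) =
    (if removable g i h then xbeta * shape_coeff g h a + shape_coeff g (h(i := h i - 1)) a else 0)"
proof (cases "srun g 0 a")
  case None
  then show ?thesis by (simp add: shape_coeff_def)
next
  case (Some p)
  obtain k h' where p: "p = (k, h')" by fastforce
  note s = Some[unfolded p]
  have g: "g \<le> h'"
    using srun_invariant[OF assms s] by simp
  define h1 where "h1 = h(i := h i - 1)"
  define h2 where "h2 = h'(i := Suc (h' i))"
  have sc: "shape_coeff g x a = (if h' = x then xbeta ^ k else 0)" for x
    by (simp add: shape_coeff_def s)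
  have h1: "addable i h1" if "removable g i h"
    unfolding h1_def by (rule addable_remove[OF that])
  have h12: "h' = h1 \<longleftrightarrow> h2 = h" if "removable g i h"
    using that unfolding h1_def h2_def by (auto simp: removable_def fun_eq_iff)
  have rhs: "(if removable g i h then xbeta * shape_coeff g h a + shape_coeff g h1 a else 0) =
      (if removable g i h then xbeta * (if h' = h then xbeta ^ k else 0) + (if h2 = h then xbeta ^ k else 0) else 0)"
    using h12 by (cases "removable g i h") (simp_all only: sc if_True if_False)
  consider (remove) "removable g i h'" | (add) "\<not> removable g i h'" "addable i h'"
    | (none) "\<not> removable g i h'" "\<not> addable i h'"
    by blast
  then show ?thesis
    unfolding h1_def[symmetric] rhs
  proof cases
    case remove
    then have "srun g 0 (a @ [i]) = Some (Suc k, h')"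
      using s by simp
    then have lhs: "shape_coeff g h (a @ [i]) = (if h' = h then xbeta ^ Suc k else 0)"
      by (simp add: shape_coeff_def)
    have "\<not> (removable g i h \<and> h' = h1)"
      using remove h1 not_removable_addable by blast
    then have "\<not> (removable g i h \<and> h2 = h)"
      using h12 by blast
    with remove lhs show "shape_coeff g h (a @ [i]) = (if removable g i h
        then xbeta * (if h' = h then xbeta ^ k else 0) + (if h2 = h then xbeta ^ k else 0) else 0)"
      by (cases "h' = h"; cases "removable g i h") simp_all
  next
    case add
    then have "srun g 0 (a @ [i]) = Some (k, h2)"
      using s unfolding h2_def by simp
    then have lhs: "shape_coeff g h (a @ [i]) = (if h2 = h then xbeta ^ k else 0)"
      by (simp add: shape_coeff_def)
    have "removable g i h2"
      unfolding h2_def by (rule removable_add[OF add(2) g])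
    with add lhs show "shape_coeff g h (a @ [i]) = (if removable g i h
        then xbeta * (if h' = h then xbeta ^ k else 0) + (if h2 = h then xbeta ^ k else 0) else 0)"
      by (cases "h' = h"; cases "removable g i h"; cases "h2 = h") simp_all
  next
    case none
    then have "srun g 0 (a @ [i]) = None"
      using s by simp
    then have lhs: "shape_coeff g h (a @ [i]) = 0"
      by (simp add: shape_coeff_def)
    have "\<not> (removable g i h \<and> h2 = h)"
      using h1 h12 none(2) by blast
    with none lhs show "shape_coeff g h (a @ [i]) = (if removable g i h
        then xbeta * (if h' = h then xbeta ^ k else 0) + (if h2 = h then xbeta ^ k else 0) else 0)"
      by (cases "h' = h"; cases "removable g i h") simp_all
  qed
qed

lemma shape_coeff_Nil: "shape_coeff g h [] = (if h = g then 1 else 0)"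
  by (auto simp: shape_coeff_def)

section \<open>Building the outer shape from the inner one\<close>

lemma exists_removable:
  assumes g: "staircase g" and h: "staircase h" "g \<le> h" "g \<noteq> h" and zero: "\<And>i. n \<le> i \<Longrightarrow> h i = 0"
  shows "\<exists>i<n. removable g i h"
proof -
  obtain i0 where "g i0 \<noteq> h i0"
    using h(3) by (auto simp: fun_eq_iff)
  then have "\<exists>i. g i < h i"
    using le_funD[OF h(2), of i0] by (intro exI[of _ i0]) simp
  then have i: "g (LEAST i. g i < h i) < h (LEAST i. g i < h i)"
    by (rule LeastI_ex)
  define i where "i = (LEAST i. g i < h i)"
  note i = i[folded i_def]
  have least: "\<not> g k < h k" if "k < i" for k
    using that unfolding i_def by (rule not_less_Least)
  have mono: "antimono h" "antimono g"
    using g h(1) unfolding antimono_iff_le_Suc staircase_def by blast+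
  \<comment> \<open>Diagonal i is the first one with a box outside g, and the row of its last box
    ends on diagonal j. No box lies below that end: for i < j by monotonicity, and for i = j because
    diagonal j - 1 lies within g, whose height there is at most g j + 1.\<close>
  define j where "j = (GREATEST j. h j = h i)"
  have bound: "k \<le> n" if "h k = h i" for k
    using that zero[of k] i by (cases "n \<le> k") simp_all
  have j: "h j = h i"
    unfolding j_def by (rule GreatestI_nat[of "\<lambda>j. h j = h i" i n]) (blast intro: bound)+
  have max: "k \<le> j" if "h k = h i" for k
    unfolding j_def using that by (rule Greatest_le_nat[of "\<lambda>j. h j = h i" k n]) (blast intro: bound)
  have "i \<le> j" using max by simp
  have "h (Suc j) \<noteq> h j"
    using max[of "Suc j"] j by auto
  moreover have "h (Suc j) \<le> h j" "h j \<le> Suc (h (Suc j))"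
    using h(1) by (simp_all add: staircase_def)
  ultimately have 1: "h j = Suc (h (Suc j))"
    by simp
  have 2: "g j < h j"
    using antimonoD[OF mono(2) \<open>i \<le> j\<close>] i j by simp
  have 3: "h k = h j" if k: "j = Suc k" for k
  proof (rule antisym)
    show "h j \<le> h k"
      unfolding k by (rule antimonoD[OF mono(1)]) simp
    show "h k \<le> h j"
    proof (cases "i = j")
      case True
      then have "h k \<le> g k"
        using least[of k] k by simp
      also have "g k \<le> Suc (g j)"
        using g unfolding k staircase_def by blast
      finally show ?thesis using 2 by simp
    next
      case False
      then have "i \<le> k" using \<open>i \<le> j\<close> k by simp
      then have "h k \<le> h i" by (rule antimonoD[OF mono(1)])
      then show ?thesis using j by simp
    qed
  qed
  have 4: "j = 0 \<or> h (j - 1) = h j"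
    using 3 by (cases j) simp_all
  have "j < n"
    using zero[of j] 2 by (cases "n \<le> j") simp_all
  then show ?thesis
    using 1 2 4 unfolding removable_def by blast
qed

lemma exists_srun:
  assumes g: "staircase g" and "staircase h" "g \<le> h" "\<And>i. n \<le> i \<Longrightarrow> h i = 0"
  shows "\<exists>a. set a \<subseteq> {..<n} \<and> srun g 0 a = Some (0, h)"
  using assms(2-)
proof (induction "\<Sum>i<n. h i" arbitrary: h rule: less_induct)
  case less
  show ?case
  proof (cases "g = h")
    case True
    then show ?thesis by (intro exI[of _ "[]"]) simp
  next
    case False
    obtain i where i: "i < n" "removable g i h"
      using exists_removable[OF g less.prems(1,2) False less.prems(3)] by blast
    let ?h = "h(i := h i - 1)"
    have "(\<Sum>i<n. ?h i) < (\<Sum>i<n. h i)"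
    proof (rule sum_strict_mono_ex1)
      show "\<exists>k\<in>{..<n}. ?h k < h k"
        using i by (intro bexI[of _ i]) (simp_all add: removable_def)
    qed simp_all
    moreover have "g \<le> ?h"
    proof (rule le_funI)
      fix k show "g k \<le> ?h k"
        using le_funD[OF less.prems(2), of k] i(2) by (simp add: removable_def)
    qed
    moreover have "?h k = 0" if "n \<le> k" for k
      using less.prems(3)[OF that] i(1) that by simp
    ultimately obtain a where a: "set a \<subseteq> {..<n}" "srun g 0 a = Some (0, ?h)"
      using less.hyps[of ?h] staircase_remove[OF less.prems(1) i(2)] by blast
    have "h = ?h(i := Suc (?h i))"
      using i(2) by (simp add: removable_def fun_eq_iff)
    then have "srun g 0 (a @ [i]) = Some (0, h)"
      using srun_snoc_add[OF a(2) addable_remove[OF i(2)]] by (simp only:)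
    then show ?thesis using a i by (intro exI[of _ "a @ [i]"]) auto
  qed
qed

section \<open>Tableaux over an ordered list of factors\<close>

definition diag_index :: "nat \<times> nat \<Rightarrow> nat" where
  "diag_index c = snd c - fst c"

definition adjacent :: "nat \<times> nat \<Rightarrow> nat \<times> nat \<Rightarrow> bool" where
  "adjacent c d \<longleftrightarrow> d = (fst c + 1, snd c) \<or> d = (fst c, snd c + 1)"

text \<open>The order in which the factors \<open>1 + x\<^sub>k u\<^sub>i\<close> occur: the pair \<open>(-k, i)\<close> stands for the factor in the
  decreasing half of the \<open>k\<close>-th block, and \<open>(k, i)\<close> for the one in the increasing half.\<close>

definition before :: "int \<times> nat \<Rightarrow> int \<times> nat \<Rightarrow> bool" where
  "before p q \<longleftrightarrow> prec (fst p) (fst q) \<or>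
    fst p = fst q \<and> (if fst p < 0 then snd q < snd p else snd p < snd q)"

lemma prec_irrefl: "\<not> prec a a"
  by (simp add: prec_def)

lemma prec_asym: "prec a b \<Longrightarrow> \<not> prec b a"
  unfolding prec_def by linarith

lemma before_asym:
  assumes "before p q"
  shows "\<not> before q p"
proof (cases "fst p = fst q")
  case True
  then show ?thesis using assms by (simp add: before_def prec_irrefl split: if_splits)
next
  case False
  then have "prec (fst p) (fst q)" using assms unfolding before_def by blast
  then show ?thesis using False prec_asym unfolding before_def by metis
qed

lemma before_irrefl: "\<not> before p p"
  by (simp add: before_def prec_irrefl)

text \<open>An entry v of a box on diagonal i records that the factor (v, i) contributed its u_i to
  that box. The single order \<open>before\<close> expresses the row and column conditions together
  and makes sense for any initial segment of the factors, as the induction on the list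
  requires.\<close>

definition ptab :: "(int \<times> nat) list \<Rightarrow> (nat \<times> nat) set \<Rightarrow> (nat \<times> nat \<Rightarrow> int set) set" where
  "ptab ps C = {T. (\<forall>c. c \<notin> C \<longrightarrow> T c = {}) \<and>
     (\<forall>c\<in>C. T c \<noteq> {} \<and> (\<forall>v\<in>T c. (v, diag_index c) \<in> set ps)) \<and>
     (\<forall>c\<in>C. \<forall>d\<in>C. adjacent c d \<longrightarrow> (\<forall>v\<in>T c. \<forall>v'\<in>T d. before (v, diag_index c) (v', diag_index d)))}"

definition tab_term :: "(nat \<times> nat) set \<Rightarrow> (nat \<times> nat \<Rightarrow> int set) \<Rightarrow> xpoly" where
  "tab_term C T = Poly_Mapping.single (\<Sum>c\<in>C. \<Sum>s\<in>T c. Poly_Mapping.single (nat \<bar>s\<bar>) 1)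
     (beta ^ ((\<Sum>c\<in>C. card (T c)) - card C))"

definition tab_sum :: "(int \<times> nat) list \<Rightarrow> (nat \<times> nat) set \<Rightarrow> xpoly" where
  "tab_sum ps C = (\<Sum>T\<in>ptab ps C. tab_term C T)"

lemma ptabI:
  assumes "\<And>c. c \<notin> C \<Longrightarrow> T c = {}" "\<And>c. c \<in> C \<Longrightarrow> T c \<noteq> {}"
    and "\<And>c v. c \<in> C \<Longrightarrow> v \<in> T c \<Longrightarrow> (v, diag_index c) \<in> set ps"
    and "\<And>c d v v'. c \<in> C \<Longrightarrow> d \<in> C \<Longrightarrow> adjacent c d \<Longrightarrow> v \<in> T c \<Longrightarrow> v' \<in> T d \<Longrightarrow>
      before (v, diag_index c) (v', diag_index d)"
  shows "T \<in> ptab ps C"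
  unfolding ptab_def using assms by blast

lemma ptab_empty: "T \<in> ptab ps C \<Longrightarrow> c \<notin> C \<Longrightarrow> T c = {}"
  unfolding ptab_def by blast

lemma ptab_nonempty: "T \<in> ptab ps C \<Longrightarrow> c \<in> C \<Longrightarrow> T c \<noteq> {}"
  unfolding ptab_def by blast

lemma ptab_before:
  "T \<in> ptab ps C \<Longrightarrow> adjacent c d \<Longrightarrow> v \<in> T c \<Longrightarrow> v' \<in> T d \<Longrightarrow>
    before (v, diag_index c) (v', diag_index d)"
  unfolding ptab_def by blast

lemma ptab_entry:
  "T \<in> ptab ps C \<Longrightarrow> v \<in> T c \<Longrightarrow> c \<in> C \<and> (v, diag_index c) \<in> set ps"
  unfolding ptab_def by blast

lemma ptab_subset:
  assumes "T \<in> ptab ps C"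
  shows "T c \<subseteq> fst ` set ps"
proof
  fix v assume "v \<in> T c"
  then have "(v, diag_index c) \<in> set ps" using ptab_entry[OF assms] by blast
  then have "fst (v, diag_index c) \<in> fst ` set ps" by (rule imageI)
  then show "v \<in> fst ` set ps" by simp
qed

lemma ptab_finite_entry: "T \<in> ptab ps C \<Longrightarrow> finite (T c)"
  by (rule finite_subset[OF ptab_subset]) simp_all

lemma finite_ptab:
  assumes "finite C"
  shows "finite (ptab ps C)"
proof (rule finite_subset)
  show "ptab ps C \<subseteq> {T. \<forall>c. (c \<in> C \<longrightarrow> T c \<in> Pow (fst ` set ps)) \<and> (c \<notin> C \<longrightarrow> T c = {})}"
  proof (intro subsetI CollectI allI conjI impI)
    fix T c assume T: "T \<in> ptab ps C"
    show "T c \<in> Pow (fst ` set ps)"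
      using ptab_subset[OF T] by simp
    show "T c = {}" if "c \<notin> C"
      using ptab_empty[OF T that] .
  qed
  show "finite {T. \<forall>c. (c \<in> C \<longrightarrow> T c \<in> Pow (fst ` set ps)) \<and> (c \<notin> C \<longrightarrow> T c = {})}"
    using assms by (intro finite_set_of_finite_funs) auto
qed

lemma tab_sum_Nil: "tab_sum [] C = (if C = {} then 1 else 0)"
proof (cases "C = {}")
  case True
  have "T \<in> ptab [] C \<longleftrightarrow> T = (\<lambda>_. {})" for T
    using True unfolding ptab_def by (simp add: fun_eq_iff)
  then have "ptab [] C = {\<lambda>_. {}}" by blast
  then show ?thesis using True by (simp add: tab_sum_def tab_term_def)
next
  case False
  then obtain c where c: "c \<in> C" by blast
  have False if T: "T \<in> ptab [] C" for T
  proof -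
    obtain v where "v \<in> T c" using ptab_nonempty[OF T c] by blast
    then show False using ptab_entry[OF T] by simp
  qed
  then have "ptab [] C = {}" by blast
  then show ?thesis using False by (simp add: tab_sum_def)
qed

lemma ptab_mono: "set ps \<subseteq> set qs \<Longrightarrow> ptab ps C \<subseteq> ptab qs C"
  unfolding ptab_def by blast

text \<open>A box to the right or below would need entries coming after the last factor.\<close>

lemma ptab_snoc_corner:
  assumes T: "T \<in> ptab (ps @ [(v, i)]) C" and ps: "\<And>q. q \<in> set ps \<Longrightarrow> before q (v, i)"
    and c: "c \<in> C" "v \<in> T c" "diag_index c = i" and d: "d \<in> C"
  shows "\<not> adjacent c d"
proof
  assume adj: "adjacent c d"
  have "T d \<noteq> {}" using T d by (rule ptab_nonempty)
  then obtain v' where v': "v' \<in> T d" by blast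
  then have "before (v, i) (v', diag_index d)"
    using ptab_before[OF T adj c(2)] c(3) by simp
  moreover have "(v', diag_index d) \<in> set ps \<or> (v', diag_index d) = (v, i)"
    using ptab_entry[OF T v'] by auto
  ultimately show False
    using ps before_asym before_irrefl by metis
qed

lemma ptab_snoc_no_corner:
  assumes ps: "\<And>q. q \<in> set ps \<Longrightarrow> before q (v, i)"
    and C: "\<And>c. c \<in> C \<Longrightarrow> diag_index c = i \<Longrightarrow> \<exists>d\<in>C. adjacent c d"
  shows "ptab (ps @ [(v, i)]) C = ptab ps C"
proof
  show "ptab (ps @ [(v, i)]) C \<subseteq> ptab ps C"
  proof
    fix T assume T: "T \<in> ptab (ps @ [(v, i)]) C"
    have "(x, diag_index c) \<in> set ps" if "c \<in> C" "x \<in> T c" for c x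
      using ptab_entry[OF T that(2)] ptab_snoc_corner[OF T ps that(1)] C[OF that(1)] that by auto
    then show "T \<in> ptab ps C"
      by (intro ptabI ptab_empty[OF T] ptab_nonempty[OF T] ptab_before[OF T])
  qed
qed (rule ptab_mono, auto)

text \<open>The situation at a removable box: \<open>c0\<close> is the only box of its diagonal that
  can receive the last factor.\<close>

context
  fixes ps :: "(int \<times> nat) list" and v :: int and i :: nat and C :: "(nat \<times> nat) set" and c0 :: "nat \<times> nat"
  assumes ps: "\<And>q. q \<in> set ps \<Longrightarrow> before q (v, i)"
    and c0: "c0 \<in> C" "diag_index c0 = i" and top: "\<And>d. d \<in> C \<Longrightarrow> \<not> adjacent c0 d"
    and corner: "\<And>c. c \<in> C \<Longrightarrow> diag_index c = i \<Longrightarrow> c \<noteq> c0 \<Longrightarrow> \<exists>d\<in>C. adjacent c d"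
    and fin: "finite C"
begin

lemma corner_entry_new: "T \<in> ptab ps D \<Longrightarrow> v \<notin> T c0"
  using ptab_entry[of T ps D v c0] ps before_irrefl c0(2) by blast

lemma ptab_snoc_insert:
  assumes T: "T \<in> ptab ps D" and D: "D = C \<or> D = C - {c0}"
  shows "T(c0 := insert v (T c0)) \<in> ptab (ps @ [(v, i)]) C"
proof -
  let ?T = "T(c0 := insert v (T c0))"
  have sub: "D \<subseteq> C" "C \<subseteq> insert c0 D" using D by auto
  have 1: "?T c = {}" if "c \<notin> C" for c
    using ptab_empty[OF T, of c] that sub c0(1) by auto
  have 2: "?T c \<noteq> {}" if "c \<in> C" for c
  proof (cases "c = c0")
    case False
    then have "c \<in> D" using that sub by auto
    from ptab_nonempty[OF T this] show ?thesis using False by simp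
  qed simp
  have 3: "(x, diag_index c) \<in> set (ps @ [(v, i)])" if "c \<in> C" "x \<in> ?T c" for c x
  proof (cases "c = c0 \<and> x = v")
    case True
    then show ?thesis using c0(2) by simp
  next
    case False
    then have "x \<in> T c" using that by (auto split: if_splits)
    from ptab_entry[OF T this] show ?thesis by simp
  qed
  have 4: "before (x, diag_index c) (y, diag_index d)"
    if "c \<in> C" "d \<in> C" "adjacent c d" "x \<in> ?T c" "y \<in> ?T d" for c d x y
  proof -
    have "c \<noteq> c0" using top that by blast
    then have c: "c \<in> D" "x \<in> T c" using that sub by auto
    show ?thesis
    proof (cases "d = c0 \<and> y = v")
      case True
      then show ?thesis using ps ptab_entry[OF T c(2)] c0(2) by simp
    next
      case False
      then have "y \<in> T d" using that by (auto split: if_splits)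
      then show ?thesis by (rule ptab_before[OF T that(3) c(2)])
    qed
  qed
  show ?thesis by (rule ptabI[OF 1 2 3 4])
qed

lemma ptab_snoc_remove:
  assumes T: "T \<in> ptab (ps @ [(v, i)]) C" and v: "v \<in> T c0"
  shows "T(c0 := T c0 - {v}) \<in> ptab ps C \<union> ptab ps (C - {c0})"
proof -
  let ?T = "T(c0 := T c0 - {v})"
  \<comment> \<open>If v was the only entry, deleting it empties \<open>c0\<close>, so the box must
    leave the shape as well.\<close>
  define D where "D = (if T c0 = {v} then C - {c0} else C)"
  have D: "D \<subseteq> C" by (auto simp: D_def)
  have sub: "?T c \<subseteq> T c" for c by auto
  have 1: "?T c = {}" if "c \<notin> D" for c
  proof (cases "c = c0")
    case True
    then have "T c0 = {v}" using that c0(1) by (simp add: D_def split: if_splits)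
    then show ?thesis using True by simp
  next
    case False
    then have "c \<notin> C" using that by (simp add: D_def split: if_splits)
    from ptab_empty[OF T this] show ?thesis using False by simp
  qed
  have 2: "?T c \<noteq> {}" if "c \<in> D" for c
  proof (cases "c = c0")
    case True
    then have "T c0 \<noteq> {v}" using that by (simp add: D_def split: if_splits)
    then show ?thesis using True v by auto
  next
    case False
    have "c \<in> C" using that D by blast
    from ptab_nonempty[OF T this] show ?thesis using False by simp
  qed
  have 3: "(x, diag_index c) \<in> set ps" if "c \<in> D" "x \<in> ?T c" for c x
  proof (rule ccontr)
    assume "(x, diag_index c) \<notin> set ps"
    moreover have xc: "x \<in> T c" using that sub by blast
    ultimately have x: "x = v" "diag_index c = i" "c \<in> C" "x \<in> T c"
      using ptab_entry[OF T xc] by auto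
    have "c \<noteq> c0"
    proof
      assume "c = c0"
      with that(2) x(1) show False by simp
    qed
    then obtain d where d: "d \<in> C" "adjacent c d" using corner[OF x(3,2)] by blast
    have "v \<in> T c" using x(1,4) by simp
    from ptab_snoc_corner[OF T ps x(3) this x(2) d(1)] d(2) show False by simp
  qed
  have 4: "before (x, diag_index c) (y, diag_index d)"
    if "c \<in> D" "d \<in> D" "adjacent c d" "x \<in> ?T c" "y \<in> ?T d" for c d x y
  proof -
    have "x \<in> T c" "y \<in> T d" using that sub by blast+
    then show ?thesis by (rule ptab_before[OF T that(3)])
  qed
  have "?T \<in> ptab ps D"
    by (rule ptabI[OF 1 2 3 4])
  then show ?thesis by (cases "T c0 = {v}") (simp_all add: D_def)
qed

lemma ptab_snoc:
  "ptab (ps @ [(v, i)]) C = ptab ps C \<union>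
    (\<lambda>T. T(c0 := insert v (T c0))) ` (ptab ps C \<union> ptab ps (C - {c0}))"
proof (intro subset_antisym subsetI)
  fix T assume T: "T \<in> ptab (ps @ [(v, i)]) C"
  show "T \<in> ptab ps C \<union> (\<lambda>T. T(c0 := insert v (T c0))) ` (ptab ps C \<union> ptab ps (C - {c0}))"
  proof (cases "v \<in> T c0")
    case True
    have "T = (T(c0 := T c0 - {v}))(c0 := insert v ((T(c0 := T c0 - {v})) c0))"
      using True by (simp add: insert_absorb)
    with ptab_snoc_remove[OF T True] show ?thesis by blast
  next
    case False
    have "(x, diag_index c) \<in> set ps" if c: "c \<in> C" "x \<in> T c" for c x
    proof (rule ccontr)
      assume "(x, diag_index c) \<notin> set ps"
      then have x: "x = v" "diag_index c = i"
        using ptab_entry[OF T c(2)] by auto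
      with False c have "c \<noteq> c0" by auto
      then obtain d where "d \<in> C" "adjacent c d" using corner[OF c(1) x(2)] by blast
      moreover have "v \<in> T c" using x(1) c(2) by simp
      ultimately show False using ptab_snoc_corner[OF T ps c(1) _ x(2)] by blast
    qed
    then have "T \<in> ptab ps C"
      by (intro ptabI ptab_empty[OF T] ptab_nonempty[OF T] ptab_before[OF T])
    then show ?thesis by blast
  qed
next
  fix T assume "T \<in> ptab ps C \<union> (\<lambda>T. T(c0 := insert v (T c0))) ` (ptab ps C \<union> ptab ps (C - {c0}))"
  then show "T \<in> ptab (ps @ [(v, i)]) C"
    using ptab_mono[of ps "ps @ [(v, i)]" C] ptab_snoc_insert by auto
qed

text \<open>The inequality makes the truncated subtraction in the exponent of \<beta> a true
  one.\<close>

lemma tab_sizes: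
  assumes T: "T \<in> ptab ps D" and D: "D = C \<or> D = C - {c0}"
  shows "(\<Sum>c\<in>C. card ((T(c0 := insert v (T c0))) c)) = Suc (\<Sum>c\<in>D. card (T c))"
    "(\<Sum>c\<in>C. \<Sum>s\<in>(T(c0 := insert v (T c0))) c. Poly_Mapping.single (nat \<bar>s\<bar>) (1::nat)) =
      Poly_Mapping.single (nat \<bar>v\<bar>) 1 + (\<Sum>c\<in>D. \<Sum>s\<in>T c. Poly_Mapping.single (nat \<bar>s\<bar>) 1)"
    "card D \<le> (\<Sum>c\<in>D. card (T c))"
proof -
  have fT: "finite (T c)" for c by (rule ptab_finite_entry[OF T])
  have v: "v \<notin> T c0" by (rule corner_entry_new[OF T])
  \<comment> \<open>With f {} = 0 the box \<open>c0\<close> may be counted even when it is missing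
    from D, so one formula serves both cases.\<close>
  have DC: "(\<Sum>c\<in>D. f (T c)) = f (T c0) + (\<Sum>c\<in>C - {c0}. f (T c))"
    if "f {} = 0" for f :: "int set \<Rightarrow> 'z::comm_monoid_add"
    using D
  proof
    assume "D = C"
    then show ?thesis using c0(1) fin by (simp add: sum.remove)
  next
    assume "D = C - {c0}"
    moreover from this have "T c0 = {}" by (intro ptab_empty[OF T]) simp
    ultimately show ?thesis using that by simp
  qed
  have CC: "(\<Sum>c\<in>C. f ((T(c0 := insert v (T c0))) c)) = f (insert v (T c0)) + (\<Sum>c\<in>C - {c0}. f (T c))"
    for f :: "int set \<Rightarrow> 'z::comm_monoid_add"
    using c0(1) fin by (simp add: sum.remove)
  show "(\<Sum>c\<in>C. card ((T(c0 := insert v (T c0))) c)) = Suc (\<Sum>c\<in>D. card (T c))"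
    unfolding CC[of card] using DC[of card] fT v by simp
  show "(\<Sum>c\<in>C. \<Sum>s\<in>(T(c0 := insert v (T c0))) c. Poly_Mapping.single (nat \<bar>s\<bar>) (1::nat)) =
      Poly_Mapping.single (nat \<bar>v\<bar>) 1 + (\<Sum>c\<in>D. \<Sum>s\<in>T c. Poly_Mapping.single (nat \<bar>s\<bar>) 1)"
    unfolding CC[of "\<lambda>A. \<Sum>s\<in>A. Poly_Mapping.single (nat \<bar>s\<bar>) (1::nat)"]
    using DC[of "\<lambda>A. \<Sum>s\<in>A. Poly_Mapping.single (nat \<bar>s\<bar>) (1::nat)"] fT v by (simp add: add.assoc)
  have "(\<Sum>c\<in>D. 1) \<le> (\<Sum>c\<in>D. card (T c))"
  proof (rule sum_mono)
    fix c assume "c \<in> D"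
    then have "T c \<noteq> {}" by (rule ptab_nonempty[OF T])
    then show "1 \<le> card (T c)" using fT by (simp add: Suc_leI card_gt_0_iff)
  qed
  then show "card D \<le> (\<Sum>c\<in>D. card (T c))" by simp
qed

text \<open>An entry added to an occupied box raises the size but not the number of boxes and so
  costs a \<beta>; an entry filling a new box raises both.\<close>

lemma tab_sum_snoc:
  "tab_sum (ps @ [(v, i)]) C =
    tab_sum ps C + xvar (nat \<bar>v\<bar>) * (xbeta * tab_sum ps C + tab_sum ps (C - {c0}))"
proof -
  let ?up = "\<lambda>T. T(c0 := insert v (T c0))"
  have inj: "inj_on ?up (ptab ps C \<union> ptab ps (C - {c0}))"
  proof (rule inj_onI)
    fix S T
    assume S: "S \<in> ptab ps C \<union> ptab ps (C - {c0})" and T: "T \<in> ptab ps C \<union> ptab ps (C - {c0})"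
      and eq: "?up S = ?up T"
    have "v \<notin> S c0" "v \<notin> T c0" using corner_entry_new S T by blast+
    moreover have "insert v (S c0) = insert v (T c0)" using fun_cong[OF eq, of c0] by simp
    ultimately have "S c0 = T c0" by auto
    moreover have "S c = T c" if "c \<noteq> c0" for c using fun_cong[OF eq, of c] that by simp
    ultimately show "S = T" by (intro ext) metis
  qed
  have disj1: "ptab ps C \<inter> ?up ` (ptab ps C \<union> ptab ps (C - {c0})) = {}"
  proof -
    have "v \<in> ?up T c0" for T by simp
    then show ?thesis using corner_entry_new by blast
  qed
  have disj2: "ptab ps C \<inter> ptab ps (C - {c0}) = {}"
  proof -
    have "T c0 \<noteq> {}" if "T \<in> ptab ps C" for T using that c0(1) by (rule ptab_nonempty)
    moreover have "T c0 = {}" if "T \<in> ptab ps (C - {c0})" for T using that by (rule ptab_empty) simp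
    ultimately show ?thesis by blast
  qed
  have fC: "finite (ptab ps C)" "finite (ptab ps (C - {c0}))"
    using fin by (simp_all add: finite_ptab)
  have up1: "tab_term C (?up T) = xvar (nat \<bar>v\<bar>) * (xbeta * tab_term C T)" if "T \<in> ptab ps C" for T
  proof -
    note sz = tab_sizes[OF that disjI1[OF refl]]
    show ?thesis
      unfolding tab_term_def sz(1,2) Suc_diff_le[OF sz(3)]
      by (simp add: xvar_def mult_single)
  qed
  have card: "card C = Suc (card (C - {c0}))"
    by (rule card.remove[OF fin c0(1)])
  have up2: "tab_term C (?up T) = xvar (nat \<bar>v\<bar>) * tab_term (C - {c0}) T" if "T \<in> ptab ps (C - {c0})" for T
  proof -
    note sz = tab_sizes[OF that disjI2[OF refl]]
    show ?thesis
      unfolding tab_term_def sz(1,2) card diff_Suc_Suc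
      by (simp add: xvar_def mult_single)
  qed
  have "tab_sum (ps @ [(v, i)]) C = tab_sum ps C +
      (\<Sum>T\<in>?up ` (ptab ps C \<union> ptab ps (C - {c0})). tab_term C T)"
    unfolding tab_sum_def ptab_snoc using disj1 fC by (subst sum.union_disjoint) auto
  also have "(\<Sum>T\<in>?up ` (ptab ps C \<union> ptab ps (C - {c0})). tab_term C T) =
      (\<Sum>T\<in>ptab ps C. tab_term C (?up T)) + (\<Sum>T\<in>ptab ps (C - {c0}). tab_term C (?up T))"
    unfolding sum.reindex[OF inj] using disj2 fC by (subst sum.union_disjoint) auto
  also have "\<dots> = xvar (nat \<bar>v\<bar>) * (xbeta * tab_sum ps C + tab_sum ps (C - {c0}))"
    unfolding tab_sum_def distrib_left sum_distrib_left
    by (intro arg_cong2[of _ _ _ _ "(+)"] sum.cong refl up1 up2)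
  finally show ?thesis .
qed

end

section \<open>Skew shifted shapes\<close>

text \<open>The strict bound from g already forces r \<ge> 1, so rows start at 1 as in
  \<open>shifted_diagram\<close>.\<close>

definition cells :: "(nat \<Rightarrow> nat) \<Rightarrow> (nat \<Rightarrow> nat) \<Rightarrow> (nat \<times> nat) set" where
  "cells g h = {(r, c). r \<le> c \<and> g (c - r) < r \<and> r \<le> h (c - r)}"

lemma cells_iff: "(r, r + i) \<in> cells g h \<longleftrightarrow> g i < r \<and> r \<le> h i"
  by (simp add: cells_def)

lemma cellsE:
  assumes "c \<in> cells g h"
  obtains r where "c = (r, r + diag_index c)" "g (diag_index c) < r" "r \<le> h (diag_index c)"
proof -
  obtain r k where c: "c = (r, k)" by fastforce
  then have "k = r + diag_index c" "g (diag_index c) < r" "r \<le> h (diag_index c)"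
    using assms by (simp_all add: cells_def diag_index_def)
  with c that show thesis by blast
qed

lemma finite_cells:
  assumes "staircase h" "\<And>i. n \<le> i \<Longrightarrow> h i = 0"
  shows "finite (cells g h)"
proof (rule finite_subset)
  have "antimono h"
    using assms(1) unfolding antimono_iff_le_Suc staircase_def by blast
  show "cells g h \<subseteq> (\<lambda>(r, i). (r, r + i)) ` ({..h 0} \<times> {..<n})"
  proof
    fix c assume "c \<in> cells g h"
    then obtain r where r: "c = (r, r + diag_index c)" "g (diag_index c) < r" "r \<le> h (diag_index c)"
      by (rule cellsE)
    have "r \<le> h 0"
      using r(3) antimonoD[OF \<open>antimono h\<close>, of 0 "diag_index c"] by simp
    moreover have "diag_index c < n"
      using assms(2)[of "diag_index c"] r(2,3) by (cases "n \<le> diag_index c") simp_all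
    ultimately show "c \<in> (\<lambda>(r, i). (r, r + i)) ` ({..h 0} \<times> {..<n})"
      by (intro image_eqI[of _ _ "(r, diag_index c)"]) (simp_all add: r(1)[symmetric])
  qed
qed simp

lemma cells_eq_empty:
  assumes "g \<le> h"
  shows "cells g h = {} \<longleftrightarrow> h = g"
proof
  assume e: "cells g h = {}"
  show "h = g"
  proof
    fix i
    have "(h i, h i + i) \<notin> cells g h" using e by simp
    then have "\<not> g i < h i" by (simp add: cells_iff)
    then show "h i = g i" using le_funD[OF assms, of i] by simp
  qed
next
  assume "h = g"
  then show "cells g h = {}" by (auto simp: cells_def)
qed

lemma adjacent_cells:
  assumes "adjacent (r, r + i) d"
  shows "d = (r, r + Suc i) \<or> d = (Suc r, r + i)"
  using assms by (auto simp: adjacent_def)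

text \<open>Supplies the assumptions on \<open>c0\<close> in \<open>tab_sum_snoc\<close> and
  identifies the smaller shape there.\<close>

lemma removable_corner:
  assumes h: "removable g i h"
  shows "(h i, h i + i) \<in> cells g h" "diag_index (h i, h i + i) = i"
    "d \<in> cells g h \<Longrightarrow> \<not> adjacent (h i, h i + i) d"
    "cells g (h(i := h i - 1)) = cells g h - {(h i, h i + i)}"
proof -
  show "(h i, h i + i) \<in> cells g h"
    using h unfolding cells_iff removable_def by simp
  show "diag_index (h i, h i + i) = i"
    by (simp add: diag_index_def)
  show "\<not> adjacent (h i, h i + i) d" if d: "d \<in> cells g h"
  proof
    assume "adjacent (h i, h i + i) d"
    then consider "d = (h i, h i + Suc i)" | "d = (Suc (h i), h i + i)"
      using adjacent_cells by blast
    then show False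
    proof cases
      case 1
      then show False using d h by (simp only: cells_iff removable_def) simp
    next
      case 2
      show False
      proof (cases i)
        case 0
        then show False using d 2 by (simp add: cells_def)
      next
        case (Suc j)
        then have "d = (Suc (h i), Suc (h i) + j)" using 2 by simp
        then have "Suc (h i) \<le> h j" using d by (simp only: cells_iff)
        then show False using h Suc by (simp add: removable_def)
      qed
    qed
  qed
  show "cells g (h(i := h i - 1)) = cells g h - {(h i, h i + i)}"
  proof (rule set_eqI)
    fix c :: "nat \<times> nat"
    obtain r k where c: "c = (r, k)" by fastforce
    show "c \<in> cells g (h(i := h i - 1)) \<longleftrightarrow> c \<in> cells g h - {(h i, h i + i)}"
    proof (cases "r \<le> k \<and> k - r = i")
      case True
      then have k: "k = r + i" by linarith
      show ?thesis
        unfolding c k using h by (auto simp: cells_iff removable_def)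
    next
      case False
      then show ?thesis
        unfolding c by (auto simp: cells_def)
    qed
  qed
qed

text \<open>Unless diagonal i + 1 supplies a right neighbour, the box is the last on its diagonal
  and ends its row; not being a corner, it has a box below. Neither neighbour lies in g, since g is
  a staircase.\<close>

lemma cell_successor:
  assumes g: "staircase g" and h: "staircase h"
    and c: "c \<in> cells g h" "diag_index c = i" and nc: "\<not> (removable g i h \<and> c = (h i, h i + i))"
  shows "\<exists>d\<in>cells g h. adjacent c d"
proof -
  obtain r where r: "c = (r, r + i)" "g i < r" "r \<le> h i"
    using cellsE[OF c(1)] c(2) by metis
  have st: "g (Suc i) \<le> g i" "h i \<le> Suc (h (Suc i))"
    using g h by (simp_all add: staircase_def)
  show ?thesis
  proof (cases "r \<le> h (Suc i)")
    case True
    then have "(r, r + Suc i) \<in> cells g h"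
      using r st by (simp only: cells_iff) simp
    moreover have "adjacent c (r, r + Suc i)"
      by (simp add: r adjacent_def)
    ultimately show ?thesis by blast
  next
    case False
    then have eq: "r = h i" "h i = Suc (h (Suc i))"
      using r(3) st(2) by simp_all
    then have "i \<noteq> 0" "h (i - 1) \<noteq> h i"
      using nc r by (auto simp: removable_def)
    then obtain j where j: "i = Suc j" "h j \<noteq> h i"
      by (cases i) simp_all
    have "g j \<le> Suc (g i)" "h i \<le> h j"
      using g h j(1) by (simp_all add: staircase_def)
    then have "(Suc r, Suc r + j) \<in> cells g h"
      using r j eq by (simp only: cells_iff) simp
    moreover have "adjacent c (Suc r, Suc r + j)"
      by (simp add: r adjacent_def j)
    ultimately show ?thesis by blast
  qed
qed

section \<open>Products of factors as sums over tableaux\<close>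

lemma lin_fun_zero: "lin (\<lambda>_. 0) f = 0"
  by (simp add: lin_def)

lemma lin_fun_linear: "lin (\<lambda>a. x * E a + E' a) f = x * lin E f + lin E' f"
  by (simp add: lin_def distrib_left sum.distrib sum_distrib_left mult.left_commute)

definition factor :: "int \<times> nat \<Rightarrow> ualg" where
  "factor p = 1 + scal (xvar (nat \<bar>fst p\<bar>)) * ugen (snd p)"

text \<open>Both sides obey one recursion in the last factor, \<open>shape_coeff_snoc\<close>
  against \<open>tab_sum_snoc\<close>. The outer shape varies in the induction because it may lose
  its corner.\<close>

lemma lin_shape_coeff_factors:
  assumes g: "staircase g" and "sorted_wrt before ps" "staircase h" "g \<le> h" "\<And>i. n \<le> i \<Longrightarrow> h i = 0"
  shows "lin (shape_coeff g h) (prod_list (map factor ps)) = tab_sum ps (cells g h)"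
  using assms(2-)
proof (induction ps arbitrary: h rule: rev_induct)
  case Nil
  have "lin (shape_coeff g h) 1 = shape_coeff g h []"
    unfolding single_one[symmetric] lin_single by (simp add: zero_uword_def)
  then show ?case
    using cells_eq_empty[OF Nil(3)] by (simp add: tab_sum_Nil shape_coeff_Nil)
next
  case (snoc p ps)
  obtain v i where p: "p = (v, i)" by fastforce
  let ?P = "prod_list (map factor ps)"
  let ?x = "xvar (nat \<bar>v\<bar>)"
  have sorted: "sorted_wrt before ps" and ps: "\<And>q. q \<in> set ps \<Longrightarrow> before q (v, i)"
    using snoc.prems(1) by (simp_all add: sorted_wrt_append p)
  have IH: "lin (shape_coeff g h) ?P = tab_sum ps (cells g h)"
    by (rule snoc.IH[OF sorted snoc.prems(2-4)])
  have step: "lin (shape_coeff g h) (prod_list (map factor (ps @ [p]))) =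
      lin (shape_coeff g h) ?P + ?x * lin (\<lambda>a. shape_coeff g h (a @ [i])) ?P"
    unfolding map_append prod_list.append by (simp add: p factor_def lin_mult_factor)
  have fin: "finite (cells g h)"
    by (rule finite_cells[OF snoc.prems(2,4)])
  show ?case
  proof (cases "removable g i h")
    case True
    let ?h = "h(i := h i - 1)"
    have "g \<le> ?h"
    proof (rule le_funI)
      fix k show "g k \<le> ?h k"
        using le_funD[OF snoc.prems(3), of k] True by (simp add: removable_def)
    qed
    moreover have "?h k = 0" if "n \<le> k" for k
      using snoc.prems(4)[OF that] by (cases "k = i") simp_all
    ultimately have IH': "lin (shape_coeff g ?h) ?P = tab_sum ps (cells g ?h)"
      using snoc.IH[OF sorted staircase_remove[OF snoc.prems(2) True]] by blast
    have "(\<lambda>a. shape_coeff g h (a @ [i])) = (\<lambda>a. xbeta * shape_coeff g h a + shape_coeff g ?h a)"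
      by (rule ext) (simp only: shape_coeff_snoc[OF g] True if_True)
    then have "lin (\<lambda>a. shape_coeff g h (a @ [i])) ?P =
        xbeta * tab_sum ps (cells g h) + tab_sum ps (cells g h - {(h i, h i + i)})"
      by (simp only: lin_fun_linear IH IH' removable_corner(4)[OF True])
    moreover have "tab_sum (ps @ [(v, i)]) (cells g h) = tab_sum ps (cells g h) +
        ?x * (xbeta * tab_sum ps (cells g h) + tab_sum ps (cells g h - {(h i, h i + i)}))"
    proof (rule tab_sum_snoc[OF ps removable_corner(1,2,3)[OF True] _ fin])
      fix c assume "c \<in> cells g h" "diag_index c = i" "c \<noteq> (h i, h i + i)"
      then show "\<exists>d\<in>cells g h. adjacent c d"
        using cell_successor[OF g snoc.prems(2)] by blast
    qed
    ultimately show ?thesis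
      by (simp only: step[unfolded p] IH p)
  next
    case False
    have "(\<lambda>a. shape_coeff g h (a @ [i])) = (\<lambda>a. 0)"
      by (rule ext) (simp only: shape_coeff_snoc[OF g] False if_False)
    then have "lin (\<lambda>a. shape_coeff g h (a @ [i])) ?P = 0"
      by (simp only: lin_fun_zero)
    moreover have "ptab (ps @ [(v, i)]) (cells g h) = ptab ps (cells g h)"
    proof (rule ptab_snoc_no_corner[OF ps])
      fix c assume "c \<in> cells g h" "diag_index c = i"
      then show "\<exists>d\<in>cells g h. adjacent c d"
        using cell_successor[OF g snoc.prems(2)] False by blast
    qed
    ultimately show ?thesis
      by (simp only: step[unfolded p] IH p tab_sum_def mult_zero_right add_0_right)
  qed
qed

section \<open>The factors of the truncated product in order\<close>

definition factor_list :: "nat \<Rightarrow> nat \<Rightarrow> (int \<times> nat) list" where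
  "factor_list n m = concat (map (\<lambda>k. map (Pair (- int k)) (rev [0..<n]) @ map (Pair (int k)) [0..<n]) [1..<Suc m])"

lemma factor_list_0 [simp]: "factor_list n 0 = []"
  by (simp add: factor_list_def)

lemma factor_list_Suc:
  "factor_list n (Suc m) = factor_list n m @
    map (Pair (- int (Suc m))) (rev [0..<n]) @ map (Pair (int (Suc m))) [0..<n]"
  by (simp add: factor_list_def)

lemma set_factor_list: "set (factor_list n m) = {(v, i). v \<noteq> 0 \<and> \<bar>v\<bar> \<le> int m \<and> i < n}"
proof (induction m)
  case (Suc m)
  show ?case
    unfolding factor_list_Suc set_append Suc by (auto simp: image_iff)
qed auto

lemma C_prod_eq_factors: "C_prod n m = prod_list (map factor (factor_list n m))"
proof (induction m)
  case 0
  then show ?case by (simp add: C_prod_def)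
next
  case (Suc m)
  have "C_prod n (Suc m) = C_prod n m * C_factor n (Suc m)"
    by (simp add: C_prod_def)
  moreover have "C_factor n (Suc m) = prod_list (map factor
      (map (Pair (- int (Suc m))) (rev [0..<n]) @ map (Pair (int (Suc m))) [0..<n]))"
  proof -
    have "nat \<bar>- int (Suc m)\<bar> = Suc m" "nat \<bar>int (Suc m)\<bar> = Suc m" by simp_all
    then show ?thesis
      unfolding C_factor_def map_append map_map comp_def factor_def fst_conv snd_conv by simp
  qed
  ultimately show ?case
    unfolding factor_list_Suc using Suc by simp
qed

lemma sorted_factor_list: "sorted_wrt before (factor_list n m)"
proof (induction m)
  case (Suc m)
  have neg: "sorted_wrt before (map (Pair (- int (Suc m))) (rev [0..<n]))"
    unfolding sorted_wrt_map sorted_wrt_rev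
    by (rule sorted_wrt_mono_rel[OF _ sorted_wrt_upt]) (simp add: before_def)
  have pos: "sorted_wrt before (map (Pair (int (Suc m))) [0..<n])"
    unfolding sorted_wrt_map
    by (rule sorted_wrt_mono_rel[OF _ sorted_wrt_upt]) (simp add: before_def)
  have mid: "before p q" if "p \<in> set (map (Pair (- int (Suc m))) (rev [0..<n]))"
    "q \<in> set (map (Pair (int (Suc m))) [0..<n])" for p q
  proof -
    have "fst p = - int (Suc m)" "fst q = int (Suc m)" using that by auto
    then show ?thesis by (simp add: before_def prec_def)
  qed
  have low: "before p q" if "p \<in> set (factor_list n m)"
    "q \<in> set (map (Pair (- int (Suc m))) (rev [0..<n]) @ map (Pair (int (Suc m))) [0..<n])" for p q
  proof -
    have "\<bar>fst q\<bar> = int (Suc m)" using that(2) by auto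
    moreover have "\<bar>fst p\<bar> \<le> int m" using that(1) by (auto simp: set_factor_list)
    ultimately show ?thesis by (simp add: before_def prec_def)
  qed
  show ?case
    unfolding factor_list_Suc sorted_wrt_append by (intro conjI ballI Suc neg pos mid low)
qed simp

section \<open>From the order of factors to the tableau conditions\<close>

definition prec_key :: "int \<Rightarrow> int" where
  "prec_key a = 2 * \<bar>a\<bar> + (if 0 < a then 1 else 0)"

text \<open>The absolute value dominates and the last bit puts -a just before a, so extrema for
  \<open>prec\<close> become ordinary \<open>Max\<close> and \<open>Min\<close> of keys.\<close>

lemma prec_iff_key: "prec a b \<longleftrightarrow> prec_key a < prec_key b"
  unfolding prec_def prec_key_def by (cases "0 < a"; cases "0 < b") (simp_all; linarith)+

lemma prec_key_inject: "prec_key a = prec_key b \<longleftrightarrow> a = b"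
proof
  assume eq: "prec_key a = prec_key b"
  show "a = b"
    using eq unfolding prec_key_def
    by (cases "0 < a"; cases "0 < b") (simp_all; presburger)+
qed simp

lemma prec_max_key:
  assumes "finite A" "A \<noteq> {}"
  shows "prec_max A \<in> A" "x \<in> A \<Longrightarrow> prec_key x \<le> prec_key (prec_max A)"
proof -
  have "Max (prec_key ` A) \<in> prec_key ` A"
    using assms by (intro Max_in) auto
  then obtain a where a: "a \<in> A" "prec_key a = Max (prec_key ` A)" by force
  have le: "prec_key x \<le> prec_key a" if "x \<in> A" for x
    using a(2) assms(1) that by simp
  have "prec_max A = a"
    unfolding prec_max_def
  proof (rule the_equality)
    show "a \<in> A \<and> (\<forall>t\<in>A. t = a \<or> prec t a)"
      using a(1) le prec_key_inject prec_iff_key by (metis order_le_less)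
  next
    fix s assume s: "s \<in> A \<and> (\<forall>t\<in>A. t = s \<or> prec t s)"
    show "s = a"
    proof (rule ccontr)
      assume "s \<noteq> a"
      then have "prec_key a < prec_key s" using s a(1) prec_iff_key by metis
      then show False using le[of s] s by simp
    qed
  qed
  then show "prec_max A \<in> A" "x \<in> A \<Longrightarrow> prec_key x \<le> prec_key (prec_max A)"
    using a(1) le by simp_all
qed

lemma prec_min_key:
  assumes "finite A" "A \<noteq> {}"
  shows "prec_min A \<in> A" "x \<in> A \<Longrightarrow> prec_key (prec_min A) \<le> prec_key x"
proof -
  have "Min (prec_key ` A) \<in> prec_key ` A"
    using assms by (intro Min_in) auto
  then obtain a where a: "a \<in> A" "prec_key a = Min (prec_key ` A)" by force
  have le: "prec_key a \<le> prec_key x" if "x \<in> A" for x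
    using a(2) assms(1) that by simp
  have "prec_min A = a"
    unfolding prec_min_def
  proof (rule the_equality)
    show "a \<in> A \<and> (\<forall>t\<in>A. t = a \<or> prec a t)"
      using a(1) le prec_key_inject prec_iff_key by (metis order_le_less)
  next
    fix s assume s: "s \<in> A \<and> (\<forall>t\<in>A. t = s \<or> prec s t)"
    show "s = a"
    proof (rule ccontr)
      assume "s \<noteq> a"
      then have "prec_key s < prec_key a" using s a(1) prec_iff_key by metis
      then show False using le[of s] s by simp
    qed
  qed
  then show "prec_min A \<in> A" "x \<in> A \<Longrightarrow> prec_key (prec_min A) \<le> prec_key x"
    using a(1) le by simp_all
qed

text \<open>A pair of entries that is not strictly increasing forces the maximum of A and the
  minimum of B to coincide with both entries, so the side condition Q concerns the same value on
  either side.\<close>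

lemma prec_max_min_iff:
  assumes "finite A" "A \<noteq> {}" "finite B" "B \<noteq> {}"
  shows "(let a = prec_max A; b = prec_min B in prec a b \<or> (a = b \<and> Q a)) \<longleftrightarrow>
    (\<forall>v\<in>A. \<forall>v'\<in>B. prec v v' \<or> (v = v' \<and> Q v))"
  unfolding Let_def
proof
  assume *: "prec (prec_max A) (prec_min B) \<or> prec_max A = prec_min B \<and> Q (prec_max A)"
  show "\<forall>v\<in>A. \<forall>v'\<in>B. prec v v' \<or> (v = v' \<and> Q v)"
  proof (intro ballI)
    fix v v' assume "v \<in> A" "v' \<in> B"
    then have le: "prec_key v \<le> prec_key (prec_max A)" "prec_key (prec_min B) \<le> prec_key v'"
      using prec_max_key(2)[OF assms(1,2)] prec_min_key(2)[OF assms(3,4)] by blast+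
    show "prec v v' \<or> (v = v' \<and> Q v)"
    proof (cases "prec_key v < prec_key v'")
      case True
      then show ?thesis by (simp add: prec_iff_key)
    next
      case False
      then have "\<not> prec (prec_max A) (prec_min B)"
        using le by (simp add: prec_iff_key)
      with * have m: "prec_max A = prec_min B" "Q (prec_max A)" by blast+
      then have "prec_key v = prec_key (prec_max A)" "prec_key v' = prec_key (prec_max A)"
        using le False by simp_all
      then have "v = prec_max A" "v' = prec_max A" by (simp_all only: prec_key_inject)
      then show ?thesis using m by simp
    qed
  qed
next
  assume "\<forall>v\<in>A. \<forall>v'\<in>B. prec v v' \<or> (v = v' \<and> Q v)"
  then show "prec (prec_max A) (prec_min B) \<or> prec_max A = prec_min B \<and> Q (prec_max A)"
    using prec_max_key(1)[OF assms(1,2)] prec_min_key(1)[OF assms(3,4)] by blast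
qed

text \<open>A step right raises the diagonal index and a step down lowers it. Since positive values
  run through the diagonals upwards and negative ones downwards, ties are allowed exactly along rows
  and columns respectively.\<close>

lemma set_valued_tableaux_iff:
  assumes C: "skew_diagram \<nu> \<mu> = C" "\<And>r c. (r, c) \<in> C \<Longrightarrow> r \<le> c"
    and T: "\<And>c. c \<notin> C \<Longrightarrow> T c = {}" "\<And>c. c \<in> C \<Longrightarrow> finite (T c)" "\<And>c. c \<in> C \<Longrightarrow> T c \<noteq> {}"
      "\<And>c. c \<in> C \<Longrightarrow> 0 \<notin> T c"
  shows "T \<in> set_valued_tableaux \<nu> \<mu> \<longleftrightarrow> (\<forall>c\<in>C. \<forall>d\<in>C. adjacent c d \<longrightarrow>
    (\<forall>v\<in>T c. \<forall>v'\<in>T d. before (v, diag_index c) (v', diag_index d)))"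
proof -
  have col: "(let a = prec_max (T (i, j)); b = prec_min (T (i + 1, j)) in prec a b \<or> (a = b \<and> a < 0)) \<longleftrightarrow>
      (\<forall>v\<in>T (i, j). \<forall>v'\<in>T (i + 1, j). before (v, diag_index (i, j)) (v', diag_index (i + 1, j)))"
    if ij: "(i, j) \<in> C" "(i + 1, j) \<in> C" for i j
  proof -
    \<comment> \<open>\<open>diag_index\<close> is a truncated difference; it drops strictly because
      the lower box is not left of the main diagonal.\<close>
    have "i + 1 \<le> j" using C(2)[OF ij(2)] .
    then have "diag_index (i + 1, j) < diag_index (i, j)"
      by (simp add: diag_index_def diff_less_mono2)
    then have "before (v, diag_index (i, j)) (v', diag_index (i + 1, j)) \<longleftrightarrow> prec v v' \<or> (v = v' \<and> v < 0)"
      for v v' by (auto simp: before_def)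
    then show ?thesis
      using prec_max_min_iff[OF T(2,3)[OF ij(1)] T(2,3)[OF ij(2)], of "\<lambda>a. a < 0"] by simp
  qed
  have row: "(let a = prec_max (T (i, j)); b = prec_min (T (i, j + 1)) in prec a b \<or> (a = b \<and> a > 0)) \<longleftrightarrow>
      (\<forall>v\<in>T (i, j). \<forall>v'\<in>T (i, j + 1). before (v, diag_index (i, j)) (v', diag_index (i, j + 1)))"
    if ij: "(i, j) \<in> C" "(i, j + 1) \<in> C" for i j
  proof -
    have "i \<le> j" using C(2)[OF ij(1)] .
    then have "diag_index (i, j) < diag_index (i, j + 1)"
      by (simp add: diag_index_def Suc_diff_le)
    then have *: "before (v, diag_index (i, j)) (v', diag_index (i, j + 1)) \<longleftrightarrow> prec v v' \<or> (v = v' \<and> v > 0)"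
      if "v \<noteq> 0" for v v' using that by (auto simp: before_def)
    have "v \<noteq> 0" if "v \<in> T (i, j)" for v
      using T(4)[OF ij(1)] that by metis
    then show ?thesis
      unfolding prec_max_min_iff[OF T(2,3)[OF ij(1)] T(2,3)[OF ij(2)], of "\<lambda>a. a > 0"]
      using * by (intro ball_cong refl) blast
  qed
  have "T \<in> set_valued_tableaux \<nu> \<mu> \<longleftrightarrow>
      (\<forall>i j. (i, j) \<in> C \<and> (i + 1, j) \<in> C \<longrightarrow>
        (let a = prec_max (T (i, j)); b = prec_min (T (i + 1, j)) in prec a b \<or> (a = b \<and> a < 0))) \<and>
      (\<forall>i j. (i, j) \<in> C \<and> (i, j + 1) \<in> C \<longrightarrow>
        (let a = prec_max (T (i, j)); b = prec_min (T (i, j + 1)) in prec a b \<or> (a = b \<and> a > 0)))"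
    unfolding set_valued_tableaux_def C(1) mem_Collect_eq using T by blast
  also have "\<dots> \<longleftrightarrow>
      (\<forall>i j. (i, j) \<in> C \<and> (i + 1, j) \<in> C \<longrightarrow>
        (\<forall>v\<in>T (i, j). \<forall>v'\<in>T (i + 1, j). before (v, diag_index (i, j)) (v', diag_index (i + 1, j)))) \<and>
      (\<forall>i j. (i, j) \<in> C \<and> (i, j + 1) \<in> C \<longrightarrow>
        (\<forall>v\<in>T (i, j). \<forall>v'\<in>T (i, j + 1). before (v, diag_index (i, j)) (v', diag_index (i, j + 1))))"
    using col row by presburger
  also have "\<dots> \<longleftrightarrow> (\<forall>c\<in>C. \<forall>d\<in>C. adjacent c d \<longrightarrow>
      (\<forall>v\<in>T c. \<forall>v'\<in>T d. before (v, diag_index c) (v', diag_index d)))"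
    unfolding adjacent_def by (force simp: split_paired_all)
  finally show ?thesis .
qed

text \<open>The first m blocks offer every nonzero value up to m in absolute value, on every
  diagonal below n.\<close>

lemma ptab_factor_list:
  assumes C: "skew_diagram \<nu> \<mu> = C" "\<And>r c. (r, c) \<in> C \<Longrightarrow> r \<le> c" "\<And>c. c \<in> C \<Longrightarrow> diag_index c < n"
  shows "ptab (factor_list n m) C = {T \<in> set_valued_tableaux \<nu> \<mu>. \<forall>c. \<forall>s\<in>T c. \<bar>s\<bar> \<le> int m}"
proof (intro subset_antisym subsetI)
  fix T assume T: "T \<in> ptab (factor_list n m) C"
  have entry: "s \<noteq> 0" "\<bar>s\<bar> \<le> int m" if "s \<in> T c" for s c
    using ptab_entry[OF T that] by (simp_all add: set_factor_list)
  have "T \<in> set_valued_tableaux \<nu> \<mu>"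
  proof (subst set_valued_tableaux_iff[OF C(1,2) ptab_empty[OF T] ptab_finite_entry[OF T] ptab_nonempty[OF T]])
    show "0 \<notin> T c" for c using entry(1) by blast
    show "\<forall>c\<in>C. \<forall>d\<in>C. adjacent c d \<longrightarrow>
      (\<forall>v\<in>T c. \<forall>v'\<in>T d. before (v, diag_index c) (v', diag_index d))"
      by (intro ballI impI ptab_before[OF T])
  qed
  then show "T \<in> {T \<in> set_valued_tableaux \<nu> \<mu>. \<forall>c. \<forall>s\<in>T c. \<bar>s\<bar> \<le> int m}"
    using entry(2) by blast
next
  fix T assume "T \<in> {T \<in> set_valued_tableaux \<nu> \<mu>. \<forall>c. \<forall>s\<in>T c. \<bar>s\<bar> \<le> int m}"
  then have T: "T \<in> set_valued_tableaux \<nu> \<mu>" and le: "\<And>c s. s \<in> T c \<Longrightarrow> \<bar>s\<bar> \<le> int m"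
    by blast+
  have t: "\<And>c. c \<notin> C \<Longrightarrow> T c = {}" "\<And>c. c \<in> C \<Longrightarrow> finite (T c)" "\<And>c. c \<in> C \<Longrightarrow> T c \<noteq> {}"
      "\<And>c. c \<in> C \<Longrightarrow> 0 \<notin> T c"
    using T unfolding set_valued_tableaux_def C(1) mem_Collect_eq by blast+
  have adj: "\<forall>c\<in>C. \<forall>d\<in>C. adjacent c d \<longrightarrow>
      (\<forall>v\<in>T c. \<forall>v'\<in>T d. before (v, diag_index c) (v', diag_index d))"
    using set_valued_tableaux_iff[of \<nu> \<mu> C T, OF C(1,2) t] T by blast
  show "T \<in> ptab (factor_list n m) C"
  proof (rule ptabI[OF t(1,3)])
    show "(v, diag_index c) \<in> set (factor_list n m)" if "c \<in> C" "v \<in> T c" for c v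
    proof -
      have "v \<noteq> 0" using t(4)[OF that(1)] that(2) by metis
      then show ?thesis using le[OF that(2)] C(3)[OF that(1)] by (simp add: set_factor_list)
    qed
    show "before (v, diag_index c) (v', diag_index d)"
      if "c \<in> C" "d \<in> C" "adjacent c d" "v \<in> T c" "v' \<in> T d" for c d v v'
      using adj that by blast
  qed
qed

text \<open>Row r of the shifted diagram meets the diagonals 0 up to its length minus 1, so the
  parts exceeding i are the rows that meet diagonal i.\<close>

definition diag_count :: "nat list \<Rightarrow> nat \<Rightarrow> nat" where
  "diag_count l i = length (filter (\<lambda>x. i < x) l)"

text \<open>In a decreasing list the entries exceeding i form an initial segment.\<close>

lemma less_length_filter_decreasing:
  "sorted_wrt (>) (l :: nat list) \<Longrightarrow>
    j < length (filter (\<lambda>x. i < x) l) \<longleftrightarrow> j < length l \<and> i < l ! j"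
proof (induction l arbitrary: j)
  case (Cons x l)
  show ?case
  proof (cases "i < x")
    case True
    then show ?thesis using Cons by (cases j) simp_all
  next
    case False
    then have small: "y < i" if "y \<in> set l" for y
      using that Cons.prems by fastforce
    then have "filter (\<lambda>x. i < x) l = []"
      by (auto simp: filter_empty_conv dest: small)
    moreover have "\<not> i < (x # l) ! j" if "j < length (x # l)"
      using that False small by (cases j) (auto dest: small[OF nth_mem])
    ultimately show ?thesis using False by auto
  qed
qed simp

text \<open>Parts are distinct, so at most one equals Suc i and is lost between two
  diagonals.\<close>

lemma diag_count_staircase:
  assumes "strict_partition l"
  shows "staircase (diag_count l)"
proof -
  have "sorted_wrt (>) l" using assms by (simp add: strict_partition_def)
  then have "length (filter (\<lambda>x. Suc i < x) l) \<le> length (filter (\<lambda>x. i < x) l) \<and>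
      length (filter (\<lambda>x. i < x) l) \<le> Suc (length (filter (\<lambda>x. Suc i < x) l))" for i
  proof (induction l)
    case (Cons x l)
    show ?case
    proof (cases "x = Suc i")
      case True
      then have "filter (\<lambda>x. i < x) l = []" "filter (\<lambda>x. Suc i < x) l = []"
        using Cons.prems by (auto simp: filter_empty_conv)
      then show ?thesis using True by simp
    next
      case False
      then have "i < x \<longleftrightarrow> Suc i < x" by auto
      then show ?thesis using Cons by simp
    qed
  qed simp
  then show ?thesis by (simp add: staircase_def diag_count_def)
qed

lemma shifted_diagram_iff:
  assumes "strict_partition l"
  shows "(r, c) \<in> shifted_diagram l \<longleftrightarrow> 1 \<le> r \<and> r \<le> c \<and> r \<le> diag_count l (c - r)"
proof (cases "1 \<le> r \<and> r \<le> c")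
  case True
  have "sorted_wrt (>) l" using assms by (simp add: strict_partition_def)
  from less_length_filter_decreasing[OF this, of "r - 1" "c - r"] True
  have "r \<le> diag_count l (c - r) \<longleftrightarrow> r \<le> length l \<and> c - r < l ! (r - 1)"
    unfolding diag_count_def by auto
  moreover have "c \<le> l ! (r - 1) + r - 1 \<longleftrightarrow> c - r < l ! (r - 1)"
    using True by auto
  ultimately show ?thesis using True by (simp add: shifted_diagram_def)
next
  case False
  then show ?thesis by (auto simp: shifted_diagram_def)
qed

lemma skew_diagram_cells:
  assumes "strict_partition \<mu>" "strict_partition \<nu>"
  shows "skew_diagram \<nu> \<mu> = cells (diag_count \<mu>) (diag_count \<nu>)"
proof (rule set_eqI)
  fix x :: "nat \<times> nat"
  obtain r c where x: "x = (r, c)" by fastforce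
  show "x \<in> skew_diagram \<nu> \<mu> \<longleftrightarrow> x \<in> cells (diag_count \<mu>) (diag_count \<nu>)"
    unfolding x skew_diagram_def Diff_iff shifted_diagram_iff[OF assms(1)] shifted_diagram_iff[OF assms(2)]
    by (auto simp: cells_def)
qed

lemma diag_count_mono:
  assumes "strict_partition \<mu>" "strict_partition \<nu>" "shifted_diagram \<mu> \<subseteq> shifted_diagram \<nu>"
  shows "diag_count \<mu> \<le> diag_count \<nu>"
proof (rule le_funI)
  fix i
  show "diag_count \<mu> i \<le> diag_count \<nu> i"
  proof (cases "diag_count \<mu> i = 0")
    case False
    let ?r = "diag_count \<mu> i"
    have "(?r, ?r + i) \<in> shifted_diagram \<mu>"
      using False by (simp add: shifted_diagram_iff[OF assms(1)])
    then have "(?r, ?r + i) \<in> shifted_diagram \<nu>" using assms(3) by blast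
    then show ?thesis by (simp add: shifted_diagram_iff[OF assms(2)])
  qed simp
qed

lemma diag_count_zero: "sum_list l \<le> i \<Longrightarrow> diag_count l i = 0"
  unfolding diag_count_def
  by (auto simp: filter_empty_conv dest!: member_le_sum_list)

lemma lin_cong:
  "(\<And>a. a \<in> Poly_Mapping.keys f \<Longrightarrow> E (letters a) = E' (letters a)) \<Longrightarrow> lin E f = lin E' f"
  unfolding lin_def by (intro sum.cong) simp_all

text \<open>Fixing the weight bounds the entries, so a truncated product already sees every tableau
  of that weight.\<close>

lemma tableau_weight_keys:
  assumes "finite (skew_diagram \<nu> \<mu>)" "T \<in> set_valued_tableaux \<nu> \<mu>" "s \<in> T c"
  shows "nat \<bar>s\<bar> \<in> Poly_Mapping.keys (tableau_weight \<nu> \<mu> T)"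
proof -
  let ?D = "skew_diagram \<nu> \<mu>"
  let ?x = "nat \<bar>s\<bar>"
  have c: "c \<in> ?D"
    using assms(2,3) unfolding set_valued_tableaux_def by blast
  then have fin: "finite (T c)"
    using assms(2) unfolding set_valued_tableaux_def by blast
  have "1 \<le> Poly_Mapping.lookup (Poly_Mapping.single (nat \<bar>s\<bar>) (1::nat)) ?x" by simp
  also have "\<dots> \<le> (\<Sum>s\<in>T c. Poly_Mapping.lookup (Poly_Mapping.single (nat \<bar>s\<bar>) 1) ?x)"
    using assms(3) fin by (intro member_le_sum) simp_all
  also have "\<dots> \<le> (\<Sum>c\<in>?D. \<Sum>s\<in>T c. Poly_Mapping.lookup (Poly_Mapping.single (nat \<bar>s\<bar>) 1) ?x)"
    using c assms(1) by (intro member_le_sum) simp_all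
  also have "\<dots> = Poly_Mapping.lookup (tableau_weight \<nu> \<mu> T) ?x"
    by (simp add: tableau_weight_def lookup_sum)
  finally show ?thesis by (simp add: in_keys_iff)
qed

theorem theorem1p5:
  fixes \<mu> \<nu> :: "nat list"
  assumes "strict_partition \<mu>" and "strict_partition \<nu>"
    and "shifted_diagram \<mu> \<subseteq> shifted_diagram \<nu>"
  shows "\<exists>n w. n \<ge> 1 \<and> w \<in> signed_perms n \<and> GC n w = GQ \<nu> \<mu>"
proof -
  define g where "g = diag_count \<mu>"
  define h where "h = diag_count \<nu>"
  \<comment> \<open>The sum of the parts exceeds every diagonal index in use; the successor keeps n
    positive for the empty partition.\<close>
  define n where "n = Suc (sum_list \<nu>)"
  define C where "C = cells g h"
  have g: "staircase g" and h: "staircase h"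
    unfolding g_def h_def by (rule diag_count_staircase[OF assms(1)], rule diag_count_staircase[OF assms(2)])
  have gh: "g \<le> h"
    unfolding g_def h_def by (rule diag_count_mono[OF assms])
  have zero: "h i = 0" if "n \<le> i" for i
    using that diag_count_zero[of \<nu> i] unfolding h_def n_def by simp
  have D: "skew_diagram \<nu> \<mu> = C"
    unfolding C_def g_def h_def by (rule skew_diagram_cells[OF assms(1,2)])
  have fin: "finite C"
    unfolding C_def by (rule finite_cells[OF h zero])
  have C: "r \<le> c" if "(r, c) \<in> C" for r c
    using that by (simp add: C_def cells_def)
  have idx: "diag_index c < n" if c: "c \<in> C" for c
  proof -
    obtain r where "g (diag_index c) < r" "r \<le> h (diag_index c)"
      using cellsE[OF c[unfolded C_def]] by metis
    then show ?thesis using zero[of "diag_index c"] by (cases "n \<le> diag_index c") simp_all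
  qed
  obtain a0 where a0: "set a0 \<subseteq> {..<n}" "srun g 0 a0 = Some (0, h)"
    using exists_srun[OF g h gh zero] by blast
  define w where "w = word_perm a0"
  have w: "w \<in> signed_perms n"
    unfolding w_def by (rule word_perm_signed_perms[OF a0(1)])
  have coeffs: "u_coeffs n (C_prod n m) w = tab_sum (factor_list n m) C" for m
  proof -
    have "u_coeffs n (C_prod n m) w = lin (dem_coeff w) (C_prod n m)"
      by (rule u_coeffs_eq_lin[OF C_prod_free_ualg w])
    also have "\<dots> = lin (shape_coeff g h) (C_prod n m)"
    proof (rule lin_cong)
      fix a assume "a \<in> Poly_Mapping.keys (C_prod n m)"
      then have "set (letters a) \<subseteq> {..<n}"
        using C_prod_free_ualg[of n m] unfolding free_ualg_def by blast
      then show "dem_coeff w (letters a) = shape_coeff g h (letters a)"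
        unfolding w_def by (rule dem_coeff_eq_shape_coeff[OF g a0])
    qed
    also have "\<dots> = tab_sum (factor_list n m) C"
      unfolding C_prod_eq_factors C_def
      by (rule lin_shape_coeff_factors[OF g sorted_factor_list h gh zero])
    finally show ?thesis .
  qed
  have "GC n w \<alpha> = GQ \<nu> \<mu> \<alpha>" for \<alpha>
  proof -
    \<comment> \<open>M bounds the indices of the variables in \<alpha>, so the coefficient is
      constant from the M-th truncation on.\<close>
    obtain M where M: "k \<le> M" if "k \<in> Poly_Mapping.keys \<alpha>" for k
      using finite_nat_set_iff_bounded_le[of "Poly_Mapping.keys \<alpha>"] by auto
    have lookup: "Poly_Mapping.lookup (u_coeffs n (C_prod n m) w) \<alpha> = GQ \<nu> \<mu> \<alpha>" if m: "M \<le> m" for m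
    proof -
      let ?P = "ptab (factor_list n m) C"
      have P: "?P = {T \<in> set_valued_tableaux \<nu> \<mu>. \<forall>c. \<forall>s\<in>T c. \<bar>s\<bar> \<le> int m}"
        by (rule ptab_factor_list[OF D C idx])
      have eq: "{T \<in> ?P. tableau_weight \<nu> \<mu> T = \<alpha>} =
          {T. T \<in> set_valued_tableaux \<nu> \<mu> \<and> tableau_weight \<nu> \<mu> T = \<alpha>}"
      proof -
        have "\<bar>s\<bar> \<le> int m"
          if "T \<in> set_valued_tableaux \<nu> \<mu>" "tableau_weight \<nu> \<mu> T = \<alpha>" "s \<in> T c" for T s c
        proof -
          have "nat \<bar>s\<bar> \<in> Poly_Mapping.keys \<alpha>"
            using tableau_weight_keys[OF _ that(1,3)] that(2) D fin by simp
          then have "nat \<bar>s\<bar> \<le> m" using M m by (meson le_trans)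
          then show ?thesis by simp
        qed
        then show ?thesis unfolding P by blast
      qed
      have "Poly_Mapping.lookup (u_coeffs n (C_prod n m) w) \<alpha> =
          (\<Sum>T\<in>?P. if tableau_weight \<nu> \<mu> T = \<alpha> then beta ^ (tableau_size \<nu> \<mu> T - card C) else 0)"
        unfolding coeffs tab_sum_def lookup_sum tab_term_def tableau_weight_def tableau_size_def D
        by (simp add: lookup_single when_def)
      also have "\<dots> = (\<Sum>T\<in>{T \<in> ?P. tableau_weight \<nu> \<mu> T = \<alpha>}. beta ^ (tableau_size \<nu> \<mu> T - card C))"
        using finite_ptab[OF fin] by (simp add: sum.inter_filter)
      also have "\<dots> = GQ \<nu> \<mu> \<alpha>"
        unfolding eq GQ_def D by simp
      finally show ?thesis .
    qed
    show ?thesis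
      unfolding GC_def
    proof (rule the_equality)
      show "\<forall>\<^sub>F m in sequentially. Poly_Mapping.lookup (u_coeffs n (C_prod n m) w) \<alpha> = GQ \<nu> \<mu> \<alpha>"
        using lookup unfolding eventually_sequentially by blast
    next
      fix c
      assume "\<forall>\<^sub>F m in sequentially. Poly_Mapping.lookup (u_coeffs n (C_prod n m) w) \<alpha> = c"
      then obtain N where "\<And>m. N \<le> m \<Longrightarrow> Poly_Mapping.lookup (u_coeffs n (C_prod n m) w) \<alpha> = c"
        unfolding eventually_sequentially by blast
      from this[of "max M N"] lookup[of "max M N"] show "c = GQ \<nu> \<mu> \<alpha>" by simp
    qed
  qed
  then have "GC n w = GQ \<nu> \<mu>" by (rule ext)
  moreover have "1 \<le> n" by (simp add: n_def)
  ultimately show ?thesis using w by blast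
qed

end
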